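(* Let $g$ be any mistake function. If $(X,f)$ is a topological dynamical system with the $g$-almost specification property and $\mu$ is an $f$-invariant ergodic Borel probability measure with $h_\mu(f)>0$, then the limits $$\overline{S}(x)=\lim_{\varepsilon\to 0}\limsup_{n\to\infty}\frac{1}{n}S_n(g;x,\varepsilon)\quad\text{and}\quad\underline{S}(x)=\lim_{\varepsilon\to 0}\liminf_{n\to\infty}\frac{1}{n}S_n(g;x,\varepsilon)$$ exist and are equal to one for $\mu$-almost every $x\in X$.
   Context: A topological dynamical system $(X,f)$ is a continuous map $f:X\to X$ on a compact metric space $(X,d)$. Mistake function: given $\varepsilon_0>0$, a function $g:\mathbb{N}\times(0,\varepsilon_0]\to\mathbb{N}$ is a mistake function if for all $\varepsilon\in(0,\varepsilon_0]$ and all $n\in\mathbb{N}$, $g(n,\varepsilon)\le g(n+1,\varepsilon)$ and $\lim_{n\to\infty} g(n,\varepsilon)/n=0$. One sets $g(n,\varepsilon)=g(n,\varepsilon_0)$ for $\varepsilon>\varepsilon_0$. For a finite set of integers $\Lambda\subset[0,N]$ let $d_\Lambda(x,y)=\max\{d(f^i x,f^i y): i\in\Lambda\}$ and $B_\Lambda(x,\varepsilon)=\{y\in X: d_\Lambda(x,y)<\varepsilon\}$. For $n\ge 1$ and $\varepsilon>0$ let $I(g;n,\varepsilon)=\{\Lambda\subset[0,n-1]\cap\mathbb{N}: \#\Lambda\ge n-g(n,\varepsilon)\}$ (here $0\in\mathbb{N}$). The mistake dynamical ball is $B_n(g;x,\varepsilon)=\bigcup_{\Lambda\in I(g;n,\varepsilon)}B_\Lambda(x,\varepsilon)$.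 Minimal return time: $S_n(g;x,\varepsilon)=\inf\{k\ge 1: f^{-k}(B_n(g;x,\varepsilon))\cap B_n(g;x,\varepsilon)\ne\emptyset\}$. $g$-almost specification property: for every sufficiently small $\varepsilon>0$ there exists a positive integer $N(g,\varepsilon)$ such that for any $x,y\in X$ and all integers $n,m\ge N(g,\varepsilon)$ one has $B_m(g;y,\varepsilon)\cap f^{-m}(B_n(g;x,\varepsilon))\ne\emptyset$. *)

theory Defs
  imports "HOL-Probability.Probability"
begin

text \<open>
  The phase space is a type of class \<open>metric_space\<close> whose universe is compact.
\<close>

definition topological_dynamical_system :: "('a::metric_space \<Rightarrow> 'a) \<Rightarrow> bool" where
  "topological_dynamical_system f \<longleftrightarrow> compact (UNIV :: 'a set) \<and> continuous_on UNIV f"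

text \<open>
  A mistake function has domain \<open>\<nat> \<times> (0, \<epsilon>0]\<close>; the last conjunct is the convention by which it
  is extended to \<open>\<epsilon> > \<epsilon>0\<close>. Its values at \<open>\<epsilon> \<le> 0\<close> are irrelevant.
\<close>

definition mistake_function :: "real \<Rightarrow> (nat \<Rightarrow> real \<Rightarrow> nat) \<Rightarrow> bool" where
  "mistake_function \<epsilon>0 g \<longleftrightarrow>
     (\<forall>\<epsilon>. 0 < \<epsilon> \<and> \<epsilon> \<le> \<epsilon>0 \<longrightarrow>
        (\<forall>n. g n \<epsilon> \<le> g (Suc n) \<epsilon>) \<and> (\<lambda>n. real (g n \<epsilon>) / real n) \<longlonglongrightarrow> 0) \<and>
     (\<forall>\<epsilon>>\<epsilon>0. \<forall>n. g n \<epsilon> = g n \<epsilon>0)"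

text \<open>
  Inserting \<open>0\<close> changes nothing for nonempty \<open>\<Lambda>\<close>, as distances are nonnegative, and fixes the
  value \<open>0\<close> for \<open>\<Lambda> = {}\<close>.
\<close>

definition orbit_dist :: "('a::metric_space \<Rightarrow> 'a) \<Rightarrow> nat set \<Rightarrow> 'a \<Rightarrow> 'a \<Rightarrow> real" where
  "orbit_dist f \<Lambda> x y = Max (insert 0 ((\<lambda>i. dist ((f ^^ i) x) ((f ^^ i) y)) ` \<Lambda>))"

definition orbit_ball :: "('a::metric_space \<Rightarrow> 'a) \<Rightarrow> nat set \<Rightarrow> 'a \<Rightarrow> real \<Rightarrow> 'a set" where
  "orbit_ball f \<Lambda> x \<epsilon> = {y. orbit_dist f \<Lambda> x y < \<epsilon>}"

text \<open>
  The subtraction is truncated, which is harmless because cardinalities are nonnegative.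
\<close>

definition mistake_index_sets :: "(nat \<Rightarrow> real \<Rightarrow> nat) \<Rightarrow> nat \<Rightarrow> real \<Rightarrow> nat set set" where
  "mistake_index_sets g n \<epsilon> = {\<Lambda>. \<Lambda> \<subseteq> {..<n} \<and> card \<Lambda> \<ge> n - g n \<epsilon>}"

definition mistake_ball ::
  "('a::metric_space \<Rightarrow> 'a) \<Rightarrow> (nat \<Rightarrow> real \<Rightarrow> nat) \<Rightarrow> nat \<Rightarrow> 'a \<Rightarrow> real \<Rightarrow> 'a set" where
  "mistake_ball f g n x \<epsilon> = (\<Union>\<Lambda>\<in>mistake_index_sets g n \<epsilon>. orbit_ball f \<Lambda> x \<epsilon>)"

text \<open>
  The infimum is taken in \<open>enat\<close>, so that it is \<open>\<infinity>\<close> if the ball never returns to itself.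
\<close>

definition min_return_time ::
  "('a::metric_space \<Rightarrow> 'a) \<Rightarrow> (nat \<Rightarrow> real \<Rightarrow> nat) \<Rightarrow> nat \<Rightarrow> 'a \<Rightarrow> real \<Rightarrow> enat" where
  "min_return_time f g n x \<epsilon> =
     Inf (enat ` {k. k \<ge> 1 \<and> (f ^^ k) -` mistake_ball f g n x \<epsilon> \<inter> mistake_ball f g n x \<epsilon> \<noteq> {}})"

definition almost_specification ::
  "('a::metric_space \<Rightarrow> 'a) \<Rightarrow> (nat \<Rightarrow> real \<Rightarrow> nat) \<Rightarrow> bool" where
  "almost_specification f g \<longleftrightarrow>
     (\<forall>\<^sub>F \<epsilon> in at_right 0. \<exists>N>0. \<forall>x y. \<forall>n\<ge>N. \<forall>m\<ge>N.
        mistake_ball f g m y \<epsilon> \<inter> (f ^^ m) -` mistake_ball f g n x \<epsilon> \<noteq> {})"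

definition invariant_measure :: "('a \<Rightarrow> 'a) \<Rightarrow> 'a measure \<Rightarrow> bool" where
  "invariant_measure f M \<longleftrightarrow> f \<in> measurable M M \<and>
     (\<forall>A\<in>sets M. emeasure M (f -` A \<inter> space M) = emeasure M A)"

definition ergodic_measure :: "('a \<Rightarrow> 'a) \<Rightarrow> 'a measure \<Rightarrow> bool" where
  "ergodic_measure f M \<longleftrightarrow> invariant_measure f M \<and>
     (\<forall>A\<in>sets M. f -` A \<inter> space M = A \<longrightarrow> measure M A = 0 \<or> measure M A = 1)"

definition finite_measurable_partition :: "'a measure \<Rightarrow> 'a set set \<Rightarrow> bool" where
  "finite_measurable_partition M P \<longleftrightarrow> finite P \<and> P \<subseteq> sets M \<and> partition_on (space M) P"

text \<open>
  Null atoms contribute \<open>0\<close>, in accordance with the convention \<open>0 log 0 = 0\<close>.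
\<close>

definition partition_entropy :: "'a measure \<Rightarrow> 'a set set \<Rightarrow> real" where
  "partition_entropy M P = - (\<Sum>A\<in>P. measure M A * ln (measure M A))"

text \<open>
  For \<open>n \<ge> 1\<close> this is the join \<open>P \<or> f\<^sup>-\<^sup>1 P \<or> \<dots> \<or> f\<^sup>-\<^sup>(\<^sup>n\<^sup>-\<^sup>1\<^sup>) P\<close>. Empty preimages are removed because
  \<open>partition_on\<close> does not admit empty atoms.
\<close>

definition iterated_partition :: "('a \<Rightarrow> 'a) \<Rightarrow> 'a measure \<Rightarrow> nat \<Rightarrow> 'a set set \<Rightarrow> 'a set set" where
  "iterated_partition f M n P =
     common_refinement ((\<lambda>i. ((\<lambda>A. (f ^^ i) -` A \<inter> space M) ` P) - {{}}) ` {..<n})"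

definition partition_dynamical_entropy :: "('a \<Rightarrow> 'a) \<Rightarrow> 'a measure \<Rightarrow> 'a set set \<Rightarrow> ereal" where
  "partition_dynamical_entropy f M P =
     lim (\<lambda>n. ereal (partition_entropy M (iterated_partition f M n P) / real n))"

text \<open>
  Kolmogorov--Sinai entropy, which may be infinite.
\<close>

definition measure_entropy :: "('a \<Rightarrow> 'a) \<Rightarrow> 'a measure \<Rightarrow> ereal" where
  "measure_entropy f M =
     (SUP P\<in>{P. finite_measurable_partition M P}. partition_dynamical_entropy f M P)"

end

theory Submission
  imports Defs
begin

text \<open>
  Specification applied to \<open>x = y\<close> and \<open>m = n\<close> makes the mistake ball return at time \<open>n\<close>, so only the
  lower bound needs the entropy. If the ball of length \<open>n\<close> returns at a time \<open>k \<le> c * n\<close> with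
  \<open>c < 1\<close>, then \<open>f\<^sup>i x\<close> and \<open>f\<^sup>i\<^sup>+\<^sup>k x\<close> are close for all but a small proportion of \<open>i < n - k\<close>.
  Choose a finite partition of positive entropy and replace its atoms by compact subsets; outside a
  set of small measure, close points then lie in the same atom, and orbits visit that set rarely by
  the maximal ergodic inequality. So the partition name of \<open>x\<close> of length \<open>n\<close> is, up to few errors,
  periodic with period \<open>k\<close>.

  Such names are few. Let \<open>h\<close> be the least rate such that the cylinders around almost every point
  are infinitely often at least \<open>exp (- h * n)\<close>, as in the Ornstein-Weiss proof of
  the Shannon-McMillan-Breiman theorem. Greedily cutting long names into blocks with such cylinders
  shows that about \<open>exp (h * k)\<close> names of length \<open>k\<close> suffice almost surely. For \<open>h = 0\<close> this would
  make the entropy vanish. For \<open>h > 0\<close> there are about \<open>exp (c * h * n)\<close> almost periodic names of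
  length \<open>n\<close>, while their cylinders have measure about \<open>exp (- h * n)\<close>, so the Borel-Cantelli lemma
  excludes them eventually.
\<close>

section \<open>Visits of orbits to small sets\<close>

definition visits :: "('a \<Rightarrow> 'a) \<Rightarrow> 'a set \<Rightarrow> nat \<Rightarrow> 'a \<Rightarrow> nat" where
  "visits f B n x = card {i. i < n \<and> (f ^^ i) x \<in> B}"

lemma visits_0 [simp]: "visits f B 0 x = 0"
  by (simp add: visits_def)

lemma visits_le: "visits f B n x \<le> n"
  using card_mono[of "{..<n}" "{i. i < n \<and> (f ^^ i) x \<in> B}"]
  by (auto simp: visits_def)

lemma visits_add: "visits f B (n + k) x = visits f B n x + visits f B k ((f ^^ n) x)"
proof -
  let ?S = "{i. i < n \<and> (f ^^ i) x \<in> B}" and ?T = "{i. i < k \<and> (f ^^ i) ((f ^^ n) x) \<in> B}"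
  have "{i. i < n + k \<and> (f ^^ i) x \<in> B} = ?S \<union> (\<lambda>i. i + n) ` ?T"
  proof (intro equalityI subsetI)
    fix i assume i: "i \<in> {i. i < n + k \<and> (f ^^ i) x \<in> B}"
    show "i \<in> ?S \<union> (\<lambda>i. i + n) ` ?T"
    proof (cases "i < n")
      case False
      then have "i = (i - n) + n" by simp
      moreover have "i - n \<in> ?T" using i False
        by (auto simp flip: funpow_add comp_apply[of "f ^^ _" "f ^^ _"])
      ultimately show ?thesis by blast
    qed (use i in auto)
  qed (auto simp: funpow_add)
  moreover have "?S \<inter> (\<lambda>i. i + n) ` ?T = {}" by auto
  moreover have "card ((\<lambda>i. i + n) ` ?T) = card ?T"
    by (rule card_image) (auto simp: inj_on_def)
  ultimately show ?thesis
    unfolding visits_def by (simp add: card_Un_disjoint)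
qed

lemma visits_Suc: "visits f B (Suc n) x = of_bool (x \<in> B) + visits f B n (f x)"
proof -
  have "visits f B 1 x = of_bool (x \<in> B)"
    by (auto simp: visits_def card_eq_0_iff of_bool_def intro: arg_cong[of _ "{0}" card, simplified])
  then show ?thesis
    using visits_add[of f B 1 n x] by simp
qed

lemma visits_indicator: "real (visits f B n x) = (\<Sum>i<n. indicator B ((f ^^ i) x))"
  by (induction n arbitrary: x)
    (auto simp: visits_Suc sum.lessThan_Suc_shift funpow_Suc_right indicator_def
      simp del: sum.lessThan_Suc funpow.simps)

text \<open>The orbit segment is scanned from the left: a point with excessive visits starts a whole
  block that is skipped at once, any other point is skipped alone.\<close>

lemma visits_greedy:
  fixes a :: real
  assumes "a \<ge> 0" and S: "\<And>x. x \<in> S \<Longrightarrow> \<exists>n\<in>{1..L}. visits f B n x \<ge> a * n"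
  shows "a * visits f S N x \<le> visits f B N x + a * L"
proof (induction N arbitrary: x rule: less_induct)
  case (less N)
  show ?case
  proof (cases "x \<in> S")
    case True
    then obtain n where n: "n \<in> {1..L}" "visits f B n x \<ge> a * n" using S by blast
    show ?thesis
    proof (cases "n \<le> N")
      case True
      define k where "k = N - n"
      then have N: "N = n + k" using True by simp
      have "a * visits f S k ((f ^^ n) x) \<le> visits f B k ((f ^^ n) x) + a * L"
        using n N by (intro less) auto
      moreover have "a * visits f S n x \<le> a * n"
        using \<open>a \<ge> 0\<close> visits_le by (intro mult_left_mono) auto
      ultimately show ?thesis
        using n by (simp add: N visits_add distrib_left)
    next
      case False
      \<comment> \<open>The last block may overrun the end of the segment; at most \<open>L\<close>
        steps are left then, which accounts for the error term \<open>a * L\<close>.\<close>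
      then have "visits f S N x \<le> L"
        using n visits_le[of f S N x] by auto
      then have "a * visits f S N x \<le> a * L"
        using \<open>a \<ge> 0\<close> by (intro mult_left_mono) auto
      then show ?thesis by simp
    qed
  next
    case False
    show ?thesis
    proof (cases N)
      case (Suc k)
      then show ?thesis
        using less[of k "f x"] False by (simp add: visits_Suc)
    qed (use \<open>a \<ge> 0\<close> in simp)
  qed
qed

section \<open>Zero-one law and maximal inequality for ergodic maps\<close>

locale ergodic_system = prob_space M for M :: "'a measure" +
  fixes f :: "'a \<Rightarrow> 'a"
  assumes ergodic: "ergodic_measure f M"
begin

lemma f_measurable [measurable]: "f \<in> measurable M M"
  using ergodic by (auto simp: ergodic_measure_def invariant_measure_def)

lemma prob_preimage: "A \<in> sets M \<Longrightarrow> prob (f -` A \<inter> space M) = prob A"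
  using ergodic by (auto simp: ergodic_measure_def invariant_measure_def measure_def)

lemma funpow_measurable [measurable]: "f ^^ n \<in> measurable M M"
proof (induction n)
  case (Suc n)
  then show ?case by (auto intro: measurable_comp[OF _ f_measurable])
qed (simp add: id_def)

lemma funpow_space: "x \<in> space M \<Longrightarrow> (f ^^ n) x \<in> space M"
  using funpow_measurable[of n] by (auto simp: measurable_def)

lemma f_space: "x \<in> space M \<Longrightarrow> f x \<in> space M"
  using f_measurable by (auto simp: measurable_def)

lemma prob_funpow_preimage: "A \<in> sets M \<Longrightarrow> prob ((f ^^ n) -` A \<inter> space M) = prob A"
proof (induction n)
  case (Suc n)
  have "(f ^^ Suc n) -` A \<inter> space M = f -` ((f ^^ n) -` A \<inter> space M) \<inter> space M"
    using f_space by (auto simp: funpow_Suc_right simp del: funpow.simps)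
  moreover have "(f ^^ n) -` A \<inter> space M \<in> sets M"
    using Suc.prems by measurable
  ultimately show ?case
    using Suc prob_preimage[of "(f ^^ n) -` A \<inter> space M"] by metis
qed (use sets.sets_into_space in \<open>auto simp: Int_absorb2\<close>)

text \<open>The preimages of \<open>S\<close> under the iterates increase, since \<open>S\<close> is
  mapped into itself, and all have the measure of \<open>S\<close>. Their union is strictly
  invariant, as the definition of ergodicity demands, and still has that measure.\<close>

lemma prob_0_1_of_forward_invariant:
  assumes S [measurable]: "S \<in> sets M" and inv: "\<And>x. x \<in> S \<Longrightarrow> f x \<in> S"
  shows "prob S = 0 \<or> prob S = 1"
proof -
  define T where "T i = (f ^^ i) -` S \<inter> space M" for i
  have [measurable]: "T i \<in> sets M" for i
    unfolding T_def by measurable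
  have "T i \<subseteq> T (Suc i)" for i
    using inv by (auto simp: T_def)
  then have inc: "incseq T"
    by (simp add: incseq_SucI)
  have "(\<lambda>i. prob (T i)) \<longlonglongrightarrow> prob (\<Union>i. T i)"
    by (rule finite_Lim_measure_incseq[OF _ inc]) auto
  moreover have "prob (T i) = prob S" for i
    unfolding T_def by (rule prob_funpow_preimage) fact
  ultimately have "prob (\<Union>i. T i) = prob S"
    by (simp add: LIMSEQ_const_iff)
  moreover have "f -` (\<Union>i. T i) \<inter> space M = (\<Union>i. T i)"
  proof (intro equalityI subsetI)
    fix x assume "x \<in> f -` (\<Union>i. T i) \<inter> space M"
    then obtain i where "f x \<in> T i" "x \<in> space M" by auto
    then have "x \<in> T (Suc i)"
      by (simp add: T_def funpow_Suc_right del: funpow.simps)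
    then show "x \<in> (\<Union>i. T i)" by blast
  next
    fix x assume "x \<in> (\<Union>i. T i)"
    then obtain i where "x \<in> T i" by auto
    then have "x \<in> T (Suc i)" using \<open>T i \<subseteq> T (Suc i)\<close> by auto
    then show "x \<in> f -` (\<Union>i. T i) \<inter> space M"
      using f_space by (auto simp: T_def funpow_Suc_right simp del: funpow.simps)
  qed
  moreover have "(\<Union>i. T i) \<in> sets M" by measurable
  ultimately show ?thesis
    using ergodic unfolding ergodic_measure_def by metis
qed

lemma visits_measurable [measurable]:
  assumes [measurable]: "B \<in> sets M"
  shows "(\<lambda>x. real (visits f B n x)) \<in> borel_measurable M"
  unfolding visits_indicator by measurable

lemma expectation_visits:
  assumes [measurable]: "B \<in> sets M"
  shows "expectation (\<lambda>x. real (visits f B n x)) = n * prob B"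
    and "integrable M (\<lambda>x. real (visits f B n x))"
proof -
  have int: "integrable M (\<lambda>x. indicator B ((f ^^ i) x) :: real)" for i
    by (rule integrable_const_bound[where B = 1]) auto
  have "expectation (\<lambda>x. indicator B ((f ^^ i) x)) = prob B" for i
  proof -
    have "expectation (\<lambda>x. indicator B ((f ^^ i) x)) =
        expectation (indicator ((f ^^ i) -` B \<inter> space M))"
      by (rule Bochner_Integration.integral_cong) (auto simp: indicator_def)
    also have "\<dots> = prob B"
      using prob_funpow_preimage[of B i] by simp
    finally show ?thesis .
  qed
  then show "expectation (\<lambda>x. real (visits f B n x)) = n * prob B"
    unfolding visits_indicator by (simp add: Bochner_Integration.integral_sum int)
  show "integrable M (\<lambda>x. real (visits f B n x))"
    unfolding visits_indicator by (intro Bochner_Integration.integrable_sum int)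
qed

text \<open>Integrating \<open>visits_greedy\<close> over orbit segments of length \<open>N\<close>
  turns each count into \<open>N\<close> times a measure; dividing by \<open>N\<close> and letting
  it tend to infinity removes the error term. The resulting bound is independent of
  \<open>L\<close>, so it passes to the union over \<open>L\<close>.\<close>

lemma maximal_inequality:
  fixes a :: real
  assumes B [measurable]: "B \<in> sets M" and "a > 0"
  shows "prob {x \<in> space M. \<exists>n\<ge>1. visits f B n x \<ge> a * n} \<le> prob B / a"
proof -
  define S where "S L = {x \<in> space M. \<exists>n\<in>{1..L}. visits f B n x \<ge> a * n}" for L :: nat
  have [measurable]: "S L \<in> sets M" for L
    unfolding S_def by measurable
  have le: "prob (S L) \<le> prob B / a" for L
  proof -
    have bound: "a * prob (S L) \<le> prob B + a * L / N" if "N > 0" for N :: nat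
    proof -
      have "expectation (\<lambda>x. a * visits f (S L) N x) \<le> expectation (\<lambda>x. visits f B N x + a * L)"
      proof (rule integral_mono)
        fix x
        show "a * visits f (S L) N x \<le> visits f B N x + a * L"
          using \<open>a > 0\<close> by (intro visits_greedy) (auto simp: S_def)
      qed (auto intro!: expectation_visits integrable_mult_right)
      then have "a * (N * prob (S L)) \<le> N * prob B + a * L"
        by (simp add: expectation_visits prob_space)
      then show ?thesis
        using that by (simp add: field_simps)
    qed
    have "(\<lambda>N. prob B + a * L / real N) \<longlonglongrightarrow> prob B + 0"
      by (intro tendsto_intros lim_const_over_n)
    then have "a * prob (S L) \<le> prob B + 0"
      by (rule LIMSEQ_le_const) (use bound in \<open>auto intro!: exI[of _ 1]\<close>)
    then show ?thesis
      using \<open>a > 0\<close> by (simp add: field_simps)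
  qed
  have "incseq S"
    by (auto simp: incseq_def S_def)
  then have "(\<lambda>L. prob (S L)) \<longlonglongrightarrow> prob (\<Union>L. S L)"
    by (intro finite_Lim_measure_incseq) auto
  then have "prob (\<Union>L. S L) \<le> prob B / a"
    by (rule LIMSEQ_le_const2) (use le in auto)
  also have "(\<Union>L. S L) = {x \<in> space M. \<exists>n\<ge>1. visits f B n x \<ge> a * n}"
    by (fastforce simp: S_def)
  finally show ?thesis .
qed

text \<open>A one-sided ergodic theorem for indicators. Allowing an arbitrary constant
  \<open>K\<close> makes the exceptional set forward invariant, as one shift lowers the count by at
  most one; the maximal inequality keeps its measure below 1, so it is null.\<close>

lemma AE_visits_le:
  fixes a :: real
  assumes B [measurable]: "B \<in> sets M" and a: "prob B < a"
  shows "AE x in M. \<exists>K::nat. \<forall>n. visits f B n x \<le> a * n + K"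
proof -
  have "a > 0" using a measure_nonneg[of M B] by linarith
  define G where "G = {x \<in> space M. \<forall>K::nat. \<exists>n. visits f B n x > a * n + K}"
  have G [measurable]: "G \<in> sets M"
    unfolding G_def by measurable
  have "f x \<in> G" if "x \<in> G" for x
  proof -
    have "\<exists>n. visits f B n (f x) > a * n + K" for K :: nat
    proof -
      obtain n where n: "visits f B n x > a * n + real (K + 1)"
        using \<open>x \<in> G\<close> unfolding G_def by blast
      then obtain k where k: "n = Suc k" by (cases n) auto
      have "real (visits f B n x) \<le> 1 + visits f B k (f x)"
        by (simp add: k visits_Suc)
      moreover have "a * k \<le> a * n" using \<open>a > 0\<close> k by simp
      ultimately show ?thesis using n by (intro exI[of _ k]) simp
    qed
    then show ?thesis using \<open>x \<in> G\<close> f_space by (auto simp: G_def)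
  qed
  then have "prob G = 0 \<or> prob G = 1"
    by (intro prob_0_1_of_forward_invariant) auto
  moreover have "prob G < 1"
  proof -
    have "G \<subseteq> {x \<in> space M. \<exists>n\<ge>1. visits f B n x \<ge> a * n}"
    proof
      fix x assume x: "x \<in> G"
      then obtain n where n: "visits f B n x > a * n + real 0"
        unfolding G_def by blast
      then have "n \<ge> 1" by (cases n) auto
      then show "x \<in> {x \<in> space M. \<exists>n\<ge>1. visits f B n x \<ge> a * n}"
        using n x by (auto simp: G_def intro!: exI[of _ n])
    qed
    then have "prob G \<le> prob {x \<in> space M. \<exists>n\<ge>1. visits f B n x \<ge> a * n}"
      by (intro finite_measure_mono) auto
    also have "\<dots> \<le> prob B / a"
      using B \<open>a > 0\<close> by (rule maximal_inequality)
    also have "\<dots> < 1"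
      using a \<open>a > 0\<close> by simp
    finally show ?thesis .
  qed
  ultimately have "AE x in M. x \<notin> G"
    by (simp add: prob_eq_0)
  with AE_space show ?thesis
    by eventually_elim (auto simp: G_def not_less)
qed

end

section \<open>Counting words\<close>

text \<open>The index \<open>s\<close> is a budget: every single letter uses one unit, blocks from
  \<open>U\<close> are free, and units may be left over.\<close>

inductive parsed :: "'b list set \<Rightarrow> 'b set \<Rightarrow> nat \<Rightarrow> 'b list \<Rightarrow> bool" for U A where
  Nil: "parsed U A s []"
| block: "u \<in> U \<Longrightarrow> parsed U A s v \<Longrightarrow> parsed U A s (u @ v)"
| letter: "a \<in> A \<Longrightarrow> parsed U A s v \<Longrightarrow> parsed U A (Suc s) (a # v)"

lemma parsed_mono: "parsed U A s w \<Longrightarrow> s \<le> s' \<Longrightarrow> parsed U A s' w"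
proof (induction arbitrary: s' rule: parsed.induct)
  case (letter a s v)
  then show ?case by (cases s') (auto intro: parsed.letter)
qed (auto intro: parsed.Nil parsed.block)

lemma parsed_letters: "set w \<subseteq> A \<Longrightarrow> parsed U A (length w) w"
  by (induction w) (auto intro: parsed.Nil parsed.letter)

lemma parsed_in_lists: "parsed U A s w \<Longrightarrow> U \<subseteq> lists A \<Longrightarrow> w \<in> lists A"
  by (induction rule: parsed.induct) auto

lemma finite_words: "finite A \<Longrightarrow> finite {w \<in> lists A. length w = n}"
  using finite_lists_length_eq[of A n] by (simp add: lists_eq_set conj_commute)

lemma card_words: "finite A \<Longrightarrow> card {w \<in> lists A. length w = n} = card A ^ n"
  using card_lists_length_eq[of A n] by (simp add: lists_eq_set conj_commute)

text \<open>Weighting a block \<open>u\<close> by \<open>exp (- (r + t) * length u)\<close> and a single letter by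
  \<open>1 / (2 * card A)\<close>, the total weight of all parsings of length \<open>N\<close> is at most \<open>1\<close>; this is
  the bound below, solved for the number of words.\<close>

lemma card_parsed_le:
  fixes r t :: real
  assumes A: "finite A" "A \<noteq> {}" and U: "U \<subseteq> lists A" "\<And>u. u \<in> U \<Longrightarrow> length u \<ge> n0" and "n0 > 0"
    and card_U: "\<And>n. card {u \<in> U. length u = n} \<le> exp (r * n)"
    and "r > 0" "t > 0" and tail: "\<And>N::nat. (\<Sum>n=n0..N. exp (- t * real n)) \<le> 1 / 2"
  shows "card {w. length w = N \<and> parsed U A s w} \<le> exp ((r + t) * N) * (2 * real (card A)) ^ s"
proof (induction N arbitrary: s rule: less_induct)
  case (less N)
  define W where "W N s = {w. length w = N \<and> parsed U A s w}" for N s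
  define U' where "U' n = {u \<in> U. length u = n}" for n
  have fin_W: "finite (W n s)" for n s
    by (rule finite_subset[OF _ finite_words[OF A(1), of n]])
      (use parsed_in_lists[OF _ U(1)] in \<open>auto simp: W_def\<close>)
  have fin_U': "finite (U' n)" for n
    by (rule finite_subset[OF _ finite_words[OF A(1), of n]]) (use U in \<open>auto simp: U'_def\<close>)
  have m: "card A \<ge> 1"
    using A by (simp add: Suc_le_eq card_gt_0_iff)
  show ?case
  proof (cases "N = 0")
    case True
    then have "{w. length w = N \<and> parsed U A s w} = {[]}"
      by (auto intro: parsed.Nil)
    moreover have "1 \<le> (2 * real (card A)) ^ s"
      using m by (intro one_le_power) simp
    ultimately show ?thesis
      using True by simp
  next
    case False
    \<comment> \<open>Parsings beginning with a block lead to \<open>X\<close>, those beginning with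
      a single letter to \<open>Y\<close>; each part may take half of the bound.\<close>
    define X where "X = (\<Union>n\<in>{n0..N}. (\<lambda>(u, v). u @ v) ` (U' n \<times> W (N - n) s))"
    define Y where "Y = (if s = 0 then {} else (\<lambda>(a, v). a # v) ` (A \<times> W (N - 1) (s - 1)))"
    have sub: "W N s \<subseteq> X \<union> Y"
    proof
      fix w assume "w \<in> W N s"
      then have w: "length w = N" "parsed U A s w" by (auto simp: W_def)
      from w(2) show "w \<in> X \<union> Y"
      proof cases
        case (block u v)
        then have "(u, v) \<in> U' (length u) \<times> W (N - length u) s" "length u \<in> {n0..N}"
          using w U by (auto simp: U'_def W_def)
        then have "w \<in> X" unfolding X_def block(1) by blast
        then show ?thesis by simp
      qed (use w False in \<open>auto simp: Y_def W_def\<close>)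
    qed
    have "card X \<le> (\<Sum>n=n0..N. card ((\<lambda>(u, v). u @ v) ` (U' n \<times> W (N - n) s)))"
      unfolding X_def by (rule card_UN_le) simp
    also have "\<dots> \<le> (\<Sum>n=n0..N. card (U' n) * card (W (N - n) s))"
      by (intro sum_mono) (metis card_cartesian_product card_image_le fin_U' fin_W finite_cartesian_product)
    finally have "real (card X) \<le> (\<Sum>n=n0..N. real (card (U' n)) * real (card (W (N - n) s)))"
      by (simp flip: of_nat_mult of_nat_sum)
    also have "\<dots> \<le> (\<Sum>n=n0..N. exp (r * n) * (exp ((r + t) * real (N - n)) * (2 * real (card A)) ^ s))"
    proof (intro sum_mono mult_mono)
      fix n assume "n \<in> {n0..N}"
      then have "N - n < N" using \<open>n0 > 0\<close> by auto
      then show "real (card (W (N - n) s)) \<le> exp ((r + t) * real (N - n)) * (2 * real (card A)) ^ s"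
        unfolding W_def by (rule less)
    qed (use card_U in \<open>auto simp: U'_def\<close>)
    \<comment> \<open>The factor \<open>exp (r * n)\<close> for the block cancels against the
      shorter remainder, leaving the tail sum that \<open>n0\<close> keeps at most one half.\<close>
    also have "\<dots> = (\<Sum>n=n0..N. exp (- t * n)) * (exp ((r + t) * N) * (2 * real (card A)) ^ s)"
      unfolding sum_distrib_right
    proof (intro sum.cong refl)
      fix n assume "n \<in> {n0..N}"
      then have "exp (r * n) * exp ((r + t) * real (N - n)) = exp (- t * n) * exp ((r + t) * N)"
        by (simp add: of_nat_diff ring_distribs flip: exp_add)
      then show "exp (r * n) * (exp ((r + t) * real (N - n)) * (2 * real (card A)) ^ s) =
          exp (- t * n) * (exp ((r + t) * N) * (2 * real (card A)) ^ s)"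
        by (simp only: mult.assoc[symmetric])
    qed
    also have "\<dots> \<le> 1 / 2 * (exp ((r + t) * N) * (2 * real (card A)) ^ s)"
      by (rule mult_right_mono[OF tail]) simp
    finally have X: "real (card X) \<le> 1 / 2 * (exp ((r + t) * N) * (2 * real (card A)) ^ s)" .
    \<comment> \<open>A letter has \<open>card A\<close> choices but lowers the budget by one; the 2
      in the base \<open>2 * card A\<close> produces the factor one half.\<close>
    have Y: "real (card Y) \<le> 1 / 2 * (exp ((r + t) * N) * (2 * real (card A)) ^ s)"
    proof (cases s)
      case (Suc s')
      have "card Y \<le> card A * card (W (N - 1) s')"
        using card_image_le[of "A \<times> W (N - 1) s'" "\<lambda>(a, v). a # v"] A fin_W
        by (simp add: Y_def Suc card_cartesian_product)
      then have "real (card Y) \<le> real (card A) * real (card (W (N - 1) s'))"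
        by (simp flip: of_nat_mult)
      also have "\<dots> \<le> card A * (exp ((r + t) * real (N - 1)) * (2 * real (card A)) ^ s')"
        using False unfolding W_def by (intro mult_left_mono less) auto
      also have "\<dots> \<le> card A * (exp ((r + t) * N) * (2 * real (card A)) ^ s')"
        using \<open>r > 0\<close> \<open>t > 0\<close> by (intro mult_left_mono mult_right_mono) auto
      finally show ?thesis by (simp add: Suc mult_ac)
    qed (simp add: Y_def)
    have "card (W N s) \<le> card (X \<union> Y)"
      using A fin_U' fin_W sub by (intro card_mono) (auto simp: X_def Y_def)
    also have "\<dots> \<le> card X + card Y" by (rule card_Un_le)
    finally show ?thesis
      using X Y unfolding W_def by simp
  qed
qed

section \<open>Words that are nearly periodic\<close>

definition shift_mismatches :: "nat \<Rightarrow> 'b list \<Rightarrow> nat" where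
  "shift_mismatches k w = card {i. i + k < length w \<and> w ! (i + k) \<noteq> w ! i}"

lemma shift_mismatches_snoc:
  assumes "0 < k" "k \<le> length v"
  shows "shift_mismatches k (v @ [a]) = shift_mismatches k v + of_bool (a \<noteq> v ! (length v - k))"
proof -
  let ?S = "{i. i + k < length v \<and> v ! (i + k) \<noteq> v ! i}"
  have "{i. i + k < length (v @ [a]) \<and> (v @ [a]) ! (i + k) \<noteq> (v @ [a]) ! i} =
      (if a \<noteq> v ! (length v - k) then insert (length v - k) ?S else ?S)"
  proof -
    have "i + k < length (v @ [a]) \<and> (v @ [a]) ! (i + k) \<noteq> (v @ [a]) ! i \<longleftrightarrow>
        i \<in> (if a \<noteq> v ! (length v - k) then insert (length v - k) ?S else ?S)" for i
    proof (cases "i + k = length v")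
      case True
      then have "i = length v - k" "i < length v" using assms by auto
      then show ?thesis using assms by (auto simp: nth_append)
    next
      case False
      then have "i \<noteq> length v - k" using assms by auto
      then show ?thesis using False assms by (auto simp: nth_append)
    qed
    then show ?thesis by blast
  qed
  moreover have "finite ?S"
    by (rule finite_subset[of _ "{..<length v}"]) auto
  ultimately show ?thesis
    using assms by (simp add: shift_mismatches_def)
qed

text \<open>After the prefix of length \<open>k\<close>, each letter either repeats the one
  \<open>k\<close> places before, a single choice, or spends one mismatch on any of
  \<open>card A\<close> letters. With a factor \<open>C\<close> granted for each allowed mismatch,
  every letter multiplies the bound by at most \<open>1 + card A / C\<close>.\<close>

lemma card_almost_periodic_le:
  fixes t C :: real
  assumes A: "finite A" and W: "W \<subseteq> lists A" "\<And>w. w \<in> W \<Longrightarrow> length w = k" and "k > 0"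
    and "C \<ge> 1" and C: "1 + card A / C \<le> exp t"
  shows "card {w \<in> lists A. length w = k + j \<and> take k w \<in> W \<and> shift_mismatches k w \<le> e}
    \<le> card W * exp (t * j) * C ^ e"
proof (induction j arbitrary: e)
  have [simp]: "finite W"
    by (rule finite_subset[OF _ finite_words[OF A, of k]]) (use W in auto)
  case 0
  have "card {w \<in> lists A. length w = k + 0 \<and> take k w \<in> W \<and> shift_mismatches k w \<le> e} \<le> card W"
    by (intro card_mono) auto
  moreover have "1 \<le> C ^ e"
    using \<open>C \<ge> 1\<close> by simp
  ultimately show ?case
    using mult_mono[of "real (card W)" "real (card W)" 1 "C ^ e"] by simp
next
  case (Suc j)
  define Q where "Q j e = {w \<in> lists A. length w = k + j \<and> take k w \<in> W \<and> shift_mismatches k w \<le> e}"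
    for j e
  have fin_Q: "finite (Q j e)" for j e
    by (rule finite_subset[OF _ finite_words[OF A, of "k + j"]]) (auto simp: Q_def)
  \<comment> \<open>As \<open>v\<close> has length \<open>k + j\<close>, the letter
    \<open>v ! j\<close> is the one \<open>k\<close> places before the appended letter.\<close>
  define X where "X = (\<lambda>v. v @ [v ! j]) ` Q j e"
  define Y where "Y = (if e = 0 then {} else (\<lambda>(v, a). v @ [a]) ` (Q j (e - 1) \<times> A))"
  have sub: "Q (Suc j) e \<subseteq> X \<union> Y"
  proof
    fix w assume w: "w \<in> Q (Suc j) e"
    then obtain v a where va: "w = v @ [a]"
      by (cases w rule: rev_cases) (auto simp: Q_def)
    then have v: "length v = k + j" "v \<in> lists A" "a \<in> A" "take k v \<in> W"
        "shift_mismatches k v + of_bool (a \<noteq> v ! j) \<le> e"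
      using w \<open>k > 0\<close> shift_mismatches_snoc[of k v a] by (auto simp: Q_def)
    show "w \<in> X \<union> Y"
    proof (cases "a = v ! j")
      case True
      then have "v \<in> Q j e" using v by (auto simp: Q_def)
      then show ?thesis unfolding X_def va True by blast
    next
      case False
      then have "v \<in> Q j (e - 1)" "e \<noteq> 0" using v by (auto simp: Q_def)
      then show ?thesis using v by (auto simp: Y_def va)
    qed
  qed
  have X: "real (card X) \<le> card W * exp (t * j) * C ^ e"
    using Suc card_image_le[OF fin_Q, of "\<lambda>v. v @ [v ! j]" j e]
    unfolding X_def Q_def[symmetric] by (meson of_nat_le_iff order_trans)
  have Y: "real (card Y) \<le> card W * exp (t * j) * C ^ e * (card A / C)"
  proof (cases e)
    case (Suc e')
    have "card Y \<le> card (Q j e') * card A"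
      using card_image_le[of "Q j e' \<times> A" "\<lambda>(v, a). v @ [a]"] A fin_Q
      by (simp add: Y_def Suc card_cartesian_product)
    then have "real (card Y) \<le> real (card (Q j e')) * real (card A)"
      by (simp flip: of_nat_mult)
    also have "\<dots> \<le> (card W * exp (t * j) * C ^ e') * card A"
      using Suc.IH[of e'] unfolding Q_def by (intro mult_right_mono) auto
    finally show ?thesis
      using \<open>C \<ge> 1\<close> by (simp add: Suc)
  qed (use \<open>C \<ge> 1\<close> in \<open>simp add: Y_def\<close>)
  have "card (Q (Suc j) e) \<le> card (X \<union> Y)"
    using A fin_Q sub by (intro card_mono) (auto simp: X_def Y_def)
  also have "\<dots> \<le> card X + card Y" by (rule card_Un_le)
  finally have "card (Q (Suc j) e) \<le> real (card X) + card Y"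
    by (simp flip: of_nat_add)
  also have "\<dots> \<le> card W * exp (t * j) * C ^ e * (1 + card A / C)"
    using X Y by (simp add: distrib_left)
  also have "\<dots> \<le> card W * exp (t * j) * C ^ e * exp t"
    using C \<open>C \<ge> 1\<close> by (intro mult_left_mono) auto
  finally show ?case
    by (simp add: Q_def exp_add algebra_simps)
qed

section \<open>Cylinders of slow decay\<close>

locale coded_ergodic_system = ergodic_system M f for M :: "'a measure" and f :: "'a \<Rightarrow> 'a" +
  fixes code :: "'a \<Rightarrow> 'b" and A :: "'b set"
  assumes finite_A: "finite A" and code_measurable: "code \<in> measurable M (count_space A)"
begin

definition word :: "nat \<Rightarrow> 'a \<Rightarrow> 'b list" where
  "word n x = map (\<lambda>i. code ((f ^^ i) x)) [0..<n]"

definition cylinder :: "'b list \<Rightarrow> 'a set" where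
  "cylinder w = {x \<in> space M. word (length w) x = w}"

lemma length_word [simp]: "length (word n x) = n"
  by (simp add: word_def)

lemma nth_word: "i < n \<Longrightarrow> word n x ! i = code ((f ^^ i) x)"
  by (simp add: word_def)

lemma word_0 [simp]: "word 0 x = []"
  by (simp add: word_def)

lemma word_add: "word (n + k) x = word n x @ word k ((f ^^ n) x)"
proof (rule nth_equalityI)
  fix i assume "i < length (word (n + k) x)"
  moreover have "(f ^^ (i - n)) ((f ^^ n) x) = (f ^^ i) x" if "\<not> i < n"
    using that funpow_add[of "i - n" n f] by simp
  ultimately show "word (n + k) x ! i = (word n x @ word k ((f ^^ n) x)) ! i"
    by (auto simp: nth_word nth_append)
qed simp

lemma word_Suc: "word (Suc n) x = code x # word n (f x)"
  using word_add[of 1 n x] by (simp add: word_def)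

lemma take_word: "k \<le> n \<Longrightarrow> take k (word n x) = word k x"
  using word_add[of k "n - k" x] by simp

lemma code_in_A: "x \<in> space M \<Longrightarrow> code x \<in> A"
  using code_measurable by (auto simp: measurable_def)

lemma word_in_lists: "x \<in> space M \<Longrightarrow> word n x \<in> lists A"
  using code_in_A funpow_space by (auto simp: word_def)

lemma A_nonempty: "A \<noteq> {}"
  using not_empty code_in_A by blast

lemma card_A_ge_1: "card A \<ge> 1"
  using finite_A A_nonempty by (simp add: Suc_le_eq card_gt_0_iff)

lemma word_measurable: "word n \<in> measurable M (count_space UNIV)"
proof -
  have cyl: "{x \<in> space M. word n x = w} \<in> sets M" for w
  proof (induction n arbitrary: w)
    case (Suc n)
    show ?case
    proof (cases w)
      case (Cons a v)
      have [measurable]: "{x \<in> space M. word n x = v} \<in> sets M" by (rule Suc)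
      have [measurable]: "code -` {a} \<inter> space M \<in> sets M"
      proof (cases "a \<in> A")
        case False
        then have "code -` {a} \<inter> space M = {}" using code_in_A by auto
        then show ?thesis by simp
      qed (use measurable_sets[OF code_measurable] in auto)
      have "{x \<in> space M. word (Suc n) x = w} =
          (code -` {a} \<inter> space M) \<inter> (f -` {x \<in> space M. word n x = v} \<inter> space M)"
        using f_space by (auto simp: word_Suc Cons)
      also have "\<dots> \<in> sets M" by measurable
      finally show ?thesis .
    qed (simp add: word_Suc)
  qed simp
  let ?W = "{w \<in> lists A. length w = n}"
  have "word n \<in> measurable M (count_space ?W)"
    by (subst measurable_count_space_eq2[OF finite_words[OF finite_A]])
      (use cyl word_in_lists in \<open>auto simp: vimage_def Int_def conj_commute\<close>)
  then show ?thesis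
    by (rule measurable_compose) simp
qed

lemma word_pred_measurable [measurable]: "Measurable.pred M (\<lambda>x. P (word n x))"
  using measurable_compose[OF word_measurable[of n], of P "count_space UNIV"] by simp

lemma cylinder_measurable [measurable]: "cylinder w \<in> sets M"
  unfolding cylinder_def by measurable

lemma sum_prob_cylinder_le_1:
  assumes "finite V" "\<And>w. w \<in> V \<Longrightarrow> length w = n"
  shows "(\<Sum>w\<in>V. prob (cylinder w)) \<le> 1"
proof -
  have "disjoint_family_on cylinder V"
    using assms by (auto simp: disjoint_family_on_def cylinder_def)
  then have "(\<Sum>w\<in>V. prob (cylinder w)) = prob (\<Union>w\<in>V. cylinder w)"
    using assms by (intro finite_measure_finite_Union[symmetric]) auto
  then show ?thesis by simp
qed

text \<open>Deleting the first letter amounts to one application of \<open>f\<close>, and preimages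
  keep their measure. This makes slow decay pass from \<open>x\<close> to
  \<open>f x\<close>.\<close>

lemma prob_cylinder_word_Suc_le: "prob (cylinder (word (Suc n) x)) \<le> prob (cylinder (word n (f x)))"
proof -
  have "cylinder (word (Suc n) x) \<subseteq> f -` cylinder (word n (f x)) \<inter> space M"
    using f_space by (auto simp: cylinder_def word_Suc)
  then have "prob (cylinder (word (Suc n) x)) \<le> prob (f -` cylinder (word n (f x)) \<inter> space M)"
    by (intro finite_measure_mono) auto
  then show ?thesis
    by (simp add: prob_preimage)
qed

text \<open>The points whose cylinders do not decay like \<open>exp (- r * n)\<close>. Asking for unbounded ratios,
  rather than for infinitely many \<open>n\<close>, makes the set exactly forward invariant.\<close>

definition slow_decay :: "real \<Rightarrow> 'a set" where
  "slow_decay r = {x \<in> space M. \<forall>K::nat. \<exists>n. prob (cylinder (word n x)) \<ge> K * exp (- r * n)}"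

lemma slow_decay_measurable [measurable]: "slow_decay r \<in> sets M"
  unfolding slow_decay_def by measurable

lemma prob_slow_decay_0_1: "prob (slow_decay r) = 0 \<or> prob (slow_decay r) = 1"
proof (rule prob_0_1_of_forward_invariant)
  fix x assume x: "x \<in> slow_decay r"
  have "\<exists>n. prob (cylinder (word n (f x))) \<ge> K * exp (- r * n)" for K :: nat
  proof -
    \<comment> \<open>The factor \<open>exp r\<close> absorbs the loss of one letter, and
      \<open>K' > 1\<close> excludes \<open>n = 0\<close>, because probabilities are at most
      1.\<close>
    define K' :: nat where "K' = nat \<lceil>K * exp r\<rceil> + 2"
    have K': "K' \<ge> K * exp r" "K' > 1"
      unfolding K'_def by linarith+
    obtain n where n: "prob (cylinder (word n x)) \<ge> K' * exp (- r * n)"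
      using x by (auto simp: slow_decay_def)
    have "n \<noteq> 0"
      using n K' prob_le_1[of "cylinder (word n x)"] by (intro notI) (simp del: prob_le_1)
    then obtain k where k: "n = Suc k" by (cases n) auto
    have "exp (- r * k) = exp r * exp (- r * n)"
      by (simp add: k ring_distribs flip: exp_add)
    then have "K * exp (- r * k) = (K * exp r) * exp (- r * n)"
      by simp
    also have "\<dots> \<le> K' * exp (- r * n)"
      by (intro mult_right_mono K') auto
    also have "\<dots> \<le> prob (cylinder (word k (f x)))"
      using n prob_cylinder_word_Suc_le[of k x] by (simp add: k)
    finally show ?thesis ..
  qed
  then show "f x \<in> slow_decay r"
    using x f_space by (auto simp: slow_decay_def)
qed simp

lemma slow_decay_mono: "r \<le> r' \<Longrightarrow> slow_decay r \<subseteq> slow_decay r'"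
proof
  fix x assume "r \<le> r'" and x: "x \<in> slow_decay r"
  show "x \<in> slow_decay r'"
    unfolding slow_decay_def
  proof (intro CollectI conjI allI)
    fix K :: nat
    obtain n where n: "prob (cylinder (word n x)) \<ge> K * exp (- r * n)"
      using x by (auto simp: slow_decay_def)
    have "K * exp (- r' * n) \<le> K * exp (- r * n)"
      using \<open>r \<le> r'\<close> by (intro mult_left_mono) (auto intro: mult_right_mono)
    with n show "\<exists>n. prob (cylinder (word n x)) \<ge> K * exp (- r' * n)"
      by (intro exI[of _ n]) linarith
  qed (use x in \<open>auto simp: slow_decay_def\<close>)
qed

text \<open>Outside \<open>slow_decay r\<close> the cylinders around a point stay below
  \<open>K * exp (- r * n)\<close> for some \<open>K\<close>. For fixed \<open>K\<close>, the
  cylinders of \<open>V n\<close> that are so small have total measure at most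
  \<open>C * K * exp ((r' - r) * n)\<close>, which is summable, so Borel-Cantelli applies; the
  countably many \<open>K\<close> are then combined.\<close>

lemma AE_word_notin:
  fixes r r' C :: real
  assumes "prob (slow_decay r) = 0" and "r' < r"
    and card_V: "\<And>n. finite (V n)" "\<And>n. card (V n) \<le> C * exp (r' * n)"
  shows "AE x in M. \<forall>\<^sub>F n in sequentially. word n x \<notin> V n"
proof -
  have "AE x in M. \<forall>\<^sub>F n in sequentially. x \<in> space M -
      {x \<in> space M. word n x \<in> V n \<and> prob (cylinder (word n x)) \<le> K * exp (- r * n)}" for K :: nat
  proof (rule borel_cantelli_AE1)
    let ?E = "\<lambda>n. {x \<in> space M. word n x \<in> V n \<and> prob (cylinder (word n x)) \<le> K * exp (- r * n)}"
    have bound: "prob (?E n) \<le> (C * K) * exp (r' - r) ^ n" for n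
    proof -
      define V' where "V' = {w \<in> V n. length w = n \<and> prob (cylinder w) \<le> K * exp (- r * n)}"
      have [simp]: "finite V'" and "card V' \<le> card (V n)"
        using card_V(1) unfolding V'_def by (auto intro: card_mono)
      have "?E n \<subseteq> (\<Union>w\<in>V'. cylinder w)"
        by (auto simp: V'_def cylinder_def)
      then have "prob (?E n) \<le> prob (\<Union>w\<in>V'. cylinder w)"
        by (intro finite_measure_mono) auto
      also have "\<dots> \<le> (\<Sum>w\<in>V'. prob (cylinder w))"
        by (intro finite_measure_subadditive_finite) auto
      also have "\<dots> \<le> (\<Sum>w\<in>V'. K * exp (- r * n))"
        by (intro sum_mono) (auto simp: V'_def)
      also have "\<dots> = card V' * (K * exp (- r * n))"
        by simp
      also have "\<dots> \<le> (C * exp (r' * n)) * (K * exp (- r * n))"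
        using \<open>card V' \<le> card (V n)\<close> card_V(2)[of n] by (intro mult_right_mono) auto
      also have "exp (r' * n) * exp (- r * n) = exp (r' - r) ^ n"
        unfolding exp_add[symmetric] exp_of_nat_mult[symmetric] by (simp add: algebra_simps)
      then have "(C * exp (r' * n)) * (K * exp (- r * n)) = (C * K) * exp (r' - r) ^ n"
        by (metis (no_types, opaque_lifting) mult.assoc mult.left_commute)
      finally show ?thesis .
    qed
    show "summable (\<lambda>n. prob (?E n))"
    proof (rule summable_comparison_test')
      show "summable (\<lambda>n. (C * K) * exp (r' - r) ^ n)"
        using \<open>r' < r\<close> by (intro summable_mult summable_geometric) auto
    qed (use bound in auto)
  qed (auto simp: less_top[symmetric])
  then have "AE x in M. \<forall>K::nat. \<forall>\<^sub>F n in sequentially. x \<in> space M -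
      {x \<in> space M. word n x \<in> V n \<and> prob (cylinder (word n x)) \<le> K * exp (- r * n)}"
    by (simp add: AE_all_countable)
  moreover have "AE x in M. x \<notin> slow_decay r"
    using assms(1) by (simp add: prob_eq_0)
  ultimately show ?thesis
    using AE_space
  proof eventually_elim
    case (elim x)
    then obtain K :: nat where K: "\<And>n. prob (cylinder (word n x)) < K * exp (- r * n)"
      by (auto simp: slow_decay_def not_le)
    from elim(1) have "\<forall>\<^sub>F n in sequentially. x \<in> space M -
      {x \<in> space M. word n x \<in> V n \<and> prob (cylinder (word n x)) \<le> K * exp (- r * n)}" by blast
    then show ?case
      by eventually_elim (use K elim(3) in \<open>auto simp: less_imp_le\<close>)
  qed
qed

text \<open>There are only \<open>card A ^ n\<close> words of length \<open>n\<close>. If a rate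
  above \<open>ln (card A)\<close> were null, \<open>AE_word_notin\<close> would exclude all words
  at once.\<close>

lemma exists_slow_decay_1: "\<exists>r>0. prob (slow_decay r) = 1"
proof -
  define r where "r = ln (card A) + 1"
  have "r > 0" using card_A_ge_1 by (simp add: r_def add_nonneg_pos)
  have "prob (slow_decay r) \<noteq> 0"
  proof
    assume "prob (slow_decay r) = 0"
    then have "AE x in M. \<forall>\<^sub>F n in sequentially. word n x \<notin> {w \<in> lists A. length w = n}"
      by (rule AE_word_notin[where r' = "ln (card A)" and C = 1])
        (use card_A_ge_1 in \<open>auto simp: r_def card_words[OF finite_A] finite_words[OF finite_A] exp_of_nat2_mult\<close>)
    then have "AE x in M. False"
      using AE_space by eventually_elim (use word_in_lists in \<open>auto simp: eventually_sequentially\<close>)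
    then show False by simp
  qed
  then show ?thesis using prob_slow_decay_0_1[of r] \<open>r > 0\<close> by auto
qed

end

text \<open>Tails of a convergent geometric series; this supplies the minimal block length for
  \<open>card_parsed_le\<close>.\<close>

lemma exists_small_tail:
  fixes t :: real
  assumes "t > 0"
  shows "\<exists>n0>0. \<forall>N::nat. (\<Sum>n=n0..N. exp (- t * real n)) \<le> 1 / 2"
proof -
  have "summable (\<lambda>n. exp (- t) ^ n)"
    using assms by (intro summable_geometric) auto
  then have "summable (\<lambda>n. exp (- t * real n))"
    by (simp add: mult.commute flip: exp_of_nat_mult)
  then obtain n1 where n1: "\<And>m n. m \<ge> n1 \<Longrightarrow> norm (\<Sum>n=m..<n. exp (- t * real n)) < 1 / 2"
    unfolding summable_Cauchy by (meson half_gt_zero zero_less_one)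
  have "(\<Sum>n=Suc n1..N. exp (- t * real n)) \<le> 1 / 2" for N
    using n1[of "Suc n1" "Suc N"] by (simp add: atLeastLessThanSuc_atLeastAtMost)
  then show ?thesis by blast
qed

section \<open>Greedy parsing of typical words\<close>

context coded_ergodic_system
begin

text \<open>Scan from the left: outside \<open>B\<close> cut off a block of \<open>U\<close>, inside
  \<open>B\<close> pay for one letter. Once at most \<open>L\<close> letters remain, a block might
  no longer fit, so these are paid for singly; hence the summand \<open>L\<close>.\<close>

lemma parsed_word:
  assumes U: "U \<subseteq> lists A" and B: "\<And>x. x \<in> space M \<Longrightarrow> x \<notin> B \<Longrightarrow> \<exists>n\<in>{1..L}. word n x \<in> U"
    and x: "x \<in> space M"
  shows "parsed U A (visits f B N x + L) (word N x)"
  using x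
proof (induction N arbitrary: x rule: less_induct)
  case (less N)
  consider (short) "N \<le> L" | (bad) "x \<in> B" "N > L" | (good) n where "n \<in> {1..L}" "word n x \<in> U" "N > L"
    using B[OF \<open>x \<in> space M\<close>] by fastforce
  then show ?case
  proof cases
    case short
    have "parsed U A (length (word N x)) (word N x)"
      using word_in_lists[OF \<open>x \<in> space M\<close>] by (intro parsed_letters) blast
    then show ?thesis
      by (rule parsed_mono) (use short in simp)
  next
    case bad
    then obtain k where k: "N = Suc k" by (cases N) auto
    show ?thesis
      using less.IH[of k "f x"] bad code_in_A less.prems f_space
      by (auto simp: k word_Suc visits_Suc intro: parsed.letter)
  next
    case good
    define k where "k = N - n"
    have N: "N = n + k" using good by (simp add: k_def)
    have "parsed U A (visits f B k ((f ^^ n) x) + L) (word k ((f ^^ n) x))"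
      using good less.prems funpow_space by (intro less.IH) (auto simp: N)
    then have "parsed U A (visits f B k ((f ^^ n) x) + L) (word N x)"
      unfolding N word_add using good by (intro parsed.block)
    then show ?thesis
      by (rule parsed_mono) (simp add: N visits_add)
  qed
qed

text \<open>Almost every long word is, up to few letters, a concatenation of words whose cylinders are
  not too small, and there are few words of the latter kind.\<close>

lemma AE_word_in_small_sets:
  fixes r r' :: real
  assumes slow: "prob (slow_decay r) = 1" and "0 < r" "r < r'"
  obtains W where "\<And>k. W k \<subseteq> {w \<in> lists A. length w = k}" "\<And>k. card (W k) \<le> exp (r' * k)"
    "AE x in M. \<forall>\<^sub>F k in sequentially. word k x \<in> W k"
proof -
  \<comment> \<open>One \<open>t\<close> pays for cutting into blocks, the other for the single
    letters.\<close>
  define t where "t = (r' - r) / 2"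
  have "t > 0" using \<open>r < r'\<close> by (simp add: t_def)
  obtain n0 where n0: "n0 > 0" "\<And>N::nat. (\<Sum>n=n0..N. exp (- t * real n)) \<le> 1 / 2"
    using exists_small_tail[OF \<open>t > 0\<close>] by blast
  \<comment> \<open>Cylinders of distinct words of equal length are disjoint, so the lower bound on
    their measure caps their number.\<close>
  define U where "U = {u \<in> lists A. length u \<ge> n0 \<and> prob (cylinder u) \<ge> exp (- r * length u)}"
  have card_U: "card {u \<in> U. length u = n} \<le> exp (r * n)" for n
  proof -
    let ?V = "{u \<in> U. length u = n}"
    have fin: "finite ?V"
      by (rule finite_subset[OF _ finite_words[OF finite_A, of n]]) (auto simp: U_def)
    have "card ?V * exp (- r * n) = (\<Sum>u\<in>?V. exp (- r * n))"
      by simp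
    also have "\<dots> \<le> (\<Sum>u\<in>?V. prob (cylinder u))"
      by (intro sum_mono) (auto simp: U_def)
    also have "\<dots> \<le> 1"
      using fin by (rule sum_prob_cylinder_le_1) auto
    finally show ?thesis
      by (simp add: exp_minus field_simps)
  qed
  \<comment> \<open>Slow decay supplies a block at almost every point, but with no common bound on
    its length. Truncating at \<open>L\<close> leaves a bad set whose measure tends to 0.\<close>
  define B where "B L = {x \<in> space M. \<forall>n\<in>{n0..L}. word n x \<notin> U}" for L
  have B_sets [measurable]: "B L \<in> sets M" for L
    unfolding B_def by measurable
  have "(\<lambda>L. prob (B L)) \<longlonglongrightarrow> prob (\<Inter>L. B L)"
    by (rule finite_Lim_measure_decseq) (auto simp: B_def decseq_def)
  moreover have "prob (\<Inter>L. B L) = 0"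
  proof -
    have "x \<notin> (\<Inter>L. B L)" if x: "x \<in> slow_decay r" for x
    proof -
      \<comment> \<open>A ratio above \<open>exp (r * n0)\<close> cannot occur for
        \<open>n < n0\<close>, as probabilities are at most 1; so the word found is long enough for
        \<open>U\<close>.\<close>
      define K :: nat where "K = nat \<lceil>exp (r * n0)\<rceil> + 2"
      have K: "K > exp (r * n0)" "K \<ge> 1"
        unfolding K_def by linarith+
      obtain n where n: "prob (cylinder (word n x)) \<ge> K * exp (- r * n)"
        using x by (auto simp: slow_decay_def)
      have "exp (r * n0) * exp (- r * n) < K * exp (- r * n)"
        using K by simp
      also have "\<dots> \<le> 1"
        using n prob_le_1 order_trans by blast
      finally have "exp (r * n0 - r * n) < 1"
        by (simp add: exp_diff exp_minus field_simps)
      then have "n \<ge> n0"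
        using \<open>0 < r\<close> by (simp add: less_imp_le)
      moreover have "exp (- r * n) \<le> K * exp (- r * n)"
        using K by simp
      then have "exp (- r * n) \<le> prob (cylinder (word n x))"
        using n by linarith
      moreover have "x \<in> space M" using x by (simp add: slow_decay_def)
      ultimately have "word n x \<in> U"
        using word_in_lists[of x n] unfolding U_def by auto
      then have "x \<notin> B n" using \<open>n \<ge> n0\<close> by (auto simp: B_def)
      then show ?thesis by blast
    qed
    then have "prob (\<Inter>L. B L) \<le> prob (space M - slow_decay r)"
      by (intro finite_measure_mono) (auto simp: B_def)
    also have "\<dots> = 0"
      using slow by (simp add: prob_compl)
    finally show ?thesis by (simp add: measure_le_0_iff)
  qed
  ultimately have lim_B: "(\<lambda>L. prob (B L)) \<longlonglongrightarrow> 0" by simp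
  have ln_pos: "ln (2 * real (card A)) > 0"
    using card_A_ge_1 by simp
  \<comment> \<open>With this choice \<open>2 * e * k\<close> single letters cost the factor
    \<open>exp (t * k)\<close>.\<close>
  define e where "e = t / (2 * ln (2 * real (card A)))"
  have "e > 0" using \<open>t > 0\<close> ln_pos by (simp add: e_def)
  then obtain L where L: "prob (B L) < e"
    using eventually_happens'[OF sequentially_bot order_tendstoD(2)[OF lim_B]] by blast
  define W where "W k = {w. length w = k \<and> parsed U A (nat \<lfloor>2 * e * k\<rfloor>) w}" for k
  show ?thesis
  proof
    show "W k \<subseteq> {w \<in> lists A. length w = k}" for k
      using parsed_in_lists[of U A] by (fastforce simp: W_def U_def)
    show "card (W k) \<le> exp (r' * k)" for k
    proof -
      have "card (W k) \<le> exp ((r + t) * k) * (2 * real (card A)) ^ nat \<lfloor>2 * e * k\<rfloor>"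
        unfolding W_def
        by (rule card_parsed_le[OF finite_A A_nonempty _ _ n0(1) card_U \<open>0 < r\<close> \<open>t > 0\<close> n0(2)])
          (auto simp: U_def)
      also have "(2 * real (card A)) ^ nat \<lfloor>2 * e * k\<rfloor> =
          exp (real (nat \<lfloor>2 * e * k\<rfloor>) * ln (2 * real (card A)))"
        using card_A_ge_1 by (simp add: exp_of_nat_mult)
      also have "\<dots> \<le> exp ((2 * e * k) * ln (2 * real (card A)))"
        unfolding exp_le_cancel_iff
        using ln_pos \<open>e > 0\<close> by (intro mult_right_mono of_nat_floor) auto
      also have "(2 * e * k) * ln (2 * real (card A)) = t * k"
        using ln_pos by (simp add: e_def)
      also have "exp ((r + t) * k) * exp (t * k) = exp (r' * k)"
        by (simp add: t_def field_simps flip: exp_add)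
      finally show ?thesis by simp
    qed
    have "AE x in M. \<exists>K::nat. \<forall>k. visits f (B L) k x \<le> e * k + K"
      using L by (intro AE_visits_le) auto
    then show "AE x in M. \<forall>\<^sub>F k in sequentially. word k x \<in> W k"
      using AE_space
    proof eventually_elim
      case (elim x)
      then obtain K :: nat where K: "\<And>k. visits f (B L) k x \<le> e * k + K" by blast
      have "\<forall>\<^sub>F k in sequentially. real k \<ge> (K + L) / e"
        by (intro eventually_compose_filterlim[OF _ filterlim_real_sequentially] eventually_ge_at_top)
      then show ?case
      proof eventually_elim
        case (elim k)
        \<comment> \<open>The constants fit into a second share \<open>e * k\<close> of the
          budget.\<close>
        then have "e * k \<ge> K + L" using \<open>e > 0\<close> by (simp add: field_simps)
        then have "real (visits f (B L) k x + L) \<le> 2 * e * k"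
          using K[of k] by simp
        then have "visits f (B L) k x + L \<le> nat \<lfloor>2 * e * k\<rfloor>"
          by (rule le_nat_floor)
        moreover have "parsed U A (visits f (B L) k x + L) (word k x)"
        proof (rule parsed_word)
          show "\<exists>n\<in>{1..L}. word n y \<in> U" if y: "y \<in> space M" "y \<notin> B L" for y
          proof -
            obtain n where "n \<in> {n0..L}" "word n y \<in> U"
              using y by (auto simp: B_def)
            then show ?thesis using \<open>n0 > 0\<close> by (intro bexI[of _ n]) auto
          qed
        qed (use \<open>x \<in> space M\<close> in \<open>auto simp: U_def\<close>)
        ultimately have "parsed U A (nat \<lfloor>2 * e * k\<rfloor>) (word k x)"
          using parsed_mono by blast
        then show ?case
          by (simp add: W_def)
      qed
    qed
  qed
qed

text \<open>Let \<open>h\<close> be the infimum of the rates of full measure; the null rate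
  \<open>r0\<close> makes it positive. Prefixes of length \<open>k \<le> c * n\<close> can be
  confined to about \<open>exp (h * c * n)\<close> words, and almost periodicity leaves little
  choice in extending them to length \<open>n\<close>. These are fewer than
  \<open>exp (r1 * n)\<close> for some \<open>r1 < h\<close>, a rate at which the cylinders do
  decay, so \<open>AE_word_notin\<close> applies.\<close>

lemma AE_shift_mismatches:
  fixes r0 c :: real
  assumes "prob (slow_decay r0) = 0" "r0 > 0" and c: "0 < c" "c < 1"
  obtains d :: real where "d > 0"
    "AE x in M. \<forall>\<^sub>F n in sequentially. \<forall>k. 1 \<le> k \<and> k \<le> c * n \<longrightarrow> shift_mismatches k (word n x) > d * n"
proof -
  define R where "R = {r. r > 0 \<and> prob (slow_decay r) = 1}"
  define h where "h = Inf R"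
  have "R \<noteq> {}" using exists_slow_decay_1 by (auto simp: R_def)
  have R_ge: "r0 \<le> r" if "r \<in> R" for r
  proof (rule ccontr)
    assume "\<not> r0 \<le> r"
    then have "prob (slow_decay r) \<le> prob (slow_decay r0)"
      by (intro finite_measure_mono slow_decay_mono) auto
    then show False using that assms by (simp add: R_def)
  qed
  have bdd: "bdd_below R"
    using R_ge by (rule bdd_belowI)
  have "h > 0"
    using cInf_greatest[OF \<open>R \<noteq> {}\<close> R_ge] \<open>r0 > 0\<close> by (simp add: h_def)
  \<comment> \<open>The midpoint of \<open>c * h\<close> and \<open>h\<close>: below
    \<open>h\<close>, hence a null rate, and above \<open>c * h\<close>, hence leaving room for a
    rate above \<open>h\<close> whose multiple by \<open>c\<close> is still smaller.\<close>
  define r1 where "r1 = h * (1 + c) / 2"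
  have "r1 < h" "r1 > 0"
    using \<open>h > 0\<close> c by (auto simp: r1_def field_simps intro: add_pos_pos)
  then have "r1 \<notin> R"
    using cInf_lower[OF _ bdd, of r1] by (auto simp: h_def)
  then have r1: "prob (slow_decay r1) = 0"
    using \<open>r1 > 0\<close> prob_slow_decay_0_1[of r1] by (auto simp: R_def)
  have "h < r1 / c"
    using \<open>h > 0\<close> c by (simp add: r1_def field_simps)
  then obtain r2 where "r2 \<in> R" "r2 < r1 / c"
    using cInf_lessD[OF \<open>R \<noteq> {}\<close>] by (auto simp: h_def)
  then obtain r3 where r3: "r2 < r3" "r3 < r1 / c" using dense by blast
  have "r2 > 0" and r2: "prob (slow_decay r2) = 1" using \<open>r2 \<in> R\<close> by (auto simp: R_def)
  have "r3 > 0" using r3 \<open>r2 > 0\<close> by simp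
  obtain W where W: "\<And>k. W k \<subseteq> {w \<in> lists A. length w = k}" "\<And>k. card (W k) \<le> exp (r3 * k)"
    "AE x in M. \<forall>\<^sub>F k in sequentially. word k x \<in> W k"
    using AE_word_in_small_sets[OF r2 \<open>r2 > 0\<close> \<open>r2 < r3\<close>] by blast
  \<comment> \<open>Three of the four shares of the gap are spent: on the letters extending the
    prefix, on the mismatches, and on the number of periods \<open>k\<close>. The fourth keeps the
    inequality strict.\<close>
  define t where "t = (r1 - c * r3) / 4"
  have "t > 0" using r3 c by (simp add: t_def field_simps)
  \<comment> \<open>Then \<open>card A / C \<le> t\<close>, so each extending letter costs at most
    \<open>exp t\<close>.\<close>
  define C where "C = max 1 (card A / t)"
  have "C \<ge> 1" by (simp add: C_def)
  have "card A / t \<le> C" by (simp add: C_def)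
  then have "1 + card A / C \<le> 1 + t"
    using \<open>t > 0\<close> \<open>C \<ge> 1\<close> by (simp add: field_simps)
  also have "\<dots> \<le> exp t" by (rule exp_ge_add_one_self)
  finally have C: "1 + card A / C \<le> exp t" .
  \<comment> \<open>So small a density of mismatches costs at most \<open>exp (t * n)\<close>; the
    summand 1 keeps the denominator positive when \<open>C = 1\<close>.\<close>
  define d where "d = t / (ln C + 1)"
  have "ln C \<ge> 0" using \<open>C \<ge> 1\<close> by simp
  then have "d > 0" "d * ln C \<le> t"
    using \<open>t > 0\<close> by (auto simp: d_def field_simps)
  have C_pow: "C ^ nat \<lfloor>d * n\<rfloor> \<le> exp (t * n)" for n :: nat
  proof -
    have "C ^ nat \<lfloor>d * n\<rfloor> = exp (real (nat \<lfloor>d * n\<rfloor>) * ln C)"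
      using \<open>C \<ge> 1\<close> by (simp add: exp_of_nat_mult)
    also have "real (nat \<lfloor>d * n\<rfloor>) * ln C \<le> (d * n) * ln C"
      using \<open>ln C \<ge> 0\<close> \<open>d > 0\<close> by (intro mult_right_mono of_nat_floor) auto
    also have "\<dots> = (d * ln C) * n" by simp
    also have "\<dots> \<le> t * n"
      using \<open>d * ln C \<le> t\<close> by (intro mult_right_mono) auto
    finally show ?thesis by simp
  qed
  \<comment> \<open>The prefix is known to lie in \<open>W k\<close> only from some length
    \<open>J\<close> on, which depends on the point. Shorter prefixes are left free at the price of
    the constant \<open>card A ^ J\<close>, and the countably many \<open>J\<close> are combined at
    the end.\<close>
  define W' where "W' J k = (if k < J then {w \<in> lists A. length w = k} else W k)" for J k
  have W'_sub: "W' J k \<subseteq> {w \<in> lists A. length w = k}" for J k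
    using W(1) by (simp add: W'_def)
  have W'_card: "card (W' J k) \<le> real (card A) ^ J * exp (r3 * k)" for J k
  proof (cases "k < J")
    case True
    have "real (card A) ^ k * 1 \<le> real (card A) ^ J * exp (r3 * k)"
      using True card_A_ge_1 \<open>r3 > 0\<close> by (intro mult_mono power_increasing) auto
    then show ?thesis using True by (simp add: W'_def card_words[OF finite_A])
  next
    case False
    have "card (W' J k) \<le> 1 * exp (r3 * k)"
      using False W(2)[of k] by (simp add: W'_def)
    also have "\<dots> \<le> real (card A) ^ J * exp (r3 * k)"
      using card_A_ge_1 by (intro mult_right_mono one_le_power) auto
    finally show ?thesis .
  qed
  define I where "I n = {k :: nat. k \<in> {1..n} \<and> real k \<le> c * real n}" for n :: nat
  have [simp]: "finite (I n)" and card_I: "card (I n) \<le> n" for n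
  proof -
    have "I n \<subseteq> {1..n}" by (auto simp: I_def)
    then show "finite (I n)" "card (I n) \<le> n"
      using card_mono[of "{1..n}" "I n"] finite_subset by auto
  qed
  define V where "V J n = (\<Union>k\<in>I n.
      {w \<in> lists A. length w = n \<and> take k w \<in> W' J k \<and> shift_mismatches k w \<le> nat \<lfloor>d * n\<rfloor>})" for J n
  have V_sub: "V J n \<subseteq> {w \<in> lists A. length w = n}" for J n
    by (auto simp: V_def)
  have "AE x in M. \<forall>\<^sub>F n in sequentially. word n x \<notin> V J n" for J
  proof (rule AE_word_notin[OF r1])
    have "4 * t = r1 - c * r3" by (simp add: t_def)
    then show "c * r3 + 3 * t < r1" using \<open>t > 0\<close> by linarith
    show "finite (V J n)" for n
      using V_sub finite_words[OF finite_A] finite_subset by blast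
    show "card (V J n) \<le> (real (card A) ^ J / t) * exp ((c * r3 + 3 * t) * n)" for n
    proof -
      define Z where "Z k = {w \<in> lists A. length w = n \<and> take k w \<in> W' J k \<and> shift_mismatches k w \<le> nat \<lfloor>d * n\<rfloor>}" for k
      define Y where "Y = real (card A) ^ J * exp (c * r3 * n) * exp (t * n) * exp (t * n)"
      have Z: "card (Z k) \<le> Y" if k: "k \<in> {1..n}" "k \<le> c * n" for k
      proof -
        have "W' J k \<subseteq> lists A" "\<And>w. w \<in> W' J k \<Longrightarrow> length w = k" "k > 0"
          using W'_sub[of J k] k by auto
        from card_almost_periodic_le[OF finite_A this \<open>C \<ge> 1\<close> C, of "n - k" "nat \<lfloor>d * n\<rfloor>"]
        have "card (Z k) \<le> card (W' J k) * exp (t * real (n - k)) * C ^ nat \<lfloor>d * n\<rfloor>"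
          using k by (simp add: Z_def)
        also have "\<dots> \<le> (real (card A) ^ J * exp (c * r3 * n)) * exp (t * n) * exp (t * n)"
        proof (intro mult_mono C_pow)
          have "r3 * k \<le> r3 * (c * n)"
            using k \<open>r3 > 0\<close> by (intro mult_left_mono) auto
          then have "real (card A) ^ J * exp (r3 * k) \<le> real (card A) ^ J * exp (c * r3 * n)"
            by (intro mult_left_mono) (auto simp: mult_ac)
          then show "card (W' J k) \<le> real (card A) ^ J * exp (c * r3 * n)"
            using W'_card[of J k] by linarith
        qed (use \<open>t > 0\<close> \<open>C \<ge> 1\<close> in auto)
        finally show ?thesis by (simp add: Y_def)
      qed
      have "card (V J n) \<le> (\<Sum>k\<in>I n. card (Z k))"
        unfolding V_def Z_def by (rule card_UN_le) simp
      then have "real (card (V J n)) \<le> (\<Sum>k\<in>I n. real (card (Z k)))"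
        by (simp flip: of_nat_sum)
      also have "\<dots> \<le> (\<Sum>k\<in>I n. Y)"
        using Z by (intro sum_mono) (auto simp: I_def)
      also have "\<dots> = card (I n) * Y" by simp
      also have "\<dots> \<le> n * Y"
        using card_I[of n] by (intro mult_right_mono) (auto simp: Y_def)
      also have "\<dots> \<le> (exp (t * n) / t) * Y"
      proof (intro mult_right_mono)
        show "n \<le> exp (t * n) / t"
        proof -
          have "t * n \<le> exp (t * n)"
            using exp_ge_add_one_self[of "t * n"] by linarith
          then show ?thesis using \<open>t > 0\<close> by (simp add: field_simps)
        qed
      qed (auto simp: Y_def)
      also have "\<dots> = (real (card A) ^ J / t) * (exp (t * n) * exp (c * r3 * n) * exp (t * n) * exp (t * n))"
        by (simp add: Y_def)
      also have "exp (t * n) * exp (c * r3 * n) * exp (t * n) * exp (t * n) = exp ((c * r3 + 3 * t) * n)"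
        unfolding exp_add[symmetric] by (simp add: algebra_simps)
      finally show ?thesis .
    qed
  qed
  then have "AE x in M. \<forall>J. \<forall>\<^sub>F n in sequentially. word n x \<notin> V J n"
    by (subst AE_all_countable) blast
  with W(3) AE_space
  have "AE x in M. \<forall>\<^sub>F n in sequentially. \<forall>k. 1 \<le> k \<and> k \<le> c * n \<longrightarrow> shift_mismatches k (word n x) > d * n"
  proof eventually_elim
    case (elim x)
    obtain J where J: "\<And>k. k \<ge> J \<Longrightarrow> word k x \<in> W k"
      using elim(1) unfolding eventually_sequentially by blast
    from elim(3) have "\<forall>\<^sub>F n in sequentially. word n x \<notin> V J n" by (rule spec)
    then show ?case
    proof eventually_elim
      case (elim n)
      show ?case
      proof (intro allI impI, rule ccontr)
        fix k assume k: "1 \<le> k \<and> k \<le> c * n" and "\<not> shift_mismatches k (word n x) > d * n"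
        then have "real (shift_mismatches k (word n x)) \<le> d * n"
          by linarith
        then have "shift_mismatches k (word n x) \<le> nat \<lfloor>d * n\<rfloor>"
          by (rule le_nat_floor)
        moreover have "c * real n \<le> 1 * real n" using c by (intro mult_right_mono) auto
        then have "k \<le> n" using k by linarith
        moreover have "take k (word n x) \<in> W' J k"
        proof (cases "k < J")
          case True
          then show ?thesis
            using word_in_lists[OF \<open>x \<in> space M\<close>, of k] \<open>k \<le> n\<close> by (simp add: take_word W'_def)
        next
          case False
          then show ?thesis
            using J[of k] \<open>k \<le> n\<close> by (simp add: take_word W'_def)
        qed
        moreover have "k \<in> I n"
          using k \<open>k \<le> n\<close> by (simp add: I_def)
        ultimately have "word n x \<in> V J n"
          using word_in_lists[OF \<open>x \<in> space M\<close>, of n] unfolding V_def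
          by (intro UN_I[of k]) simp_all
        then show False using elim by blast
      qed
    qed
  qed
  with \<open>d > 0\<close> show ?thesis by (rule that)
qed

end

section \<open>Regularity and separation in metric spaces\<close>

lemma closed_eq_INT_open:
  fixes F :: "'a::metric_space set"
  assumes "closed F"
  shows "\<exists>U :: nat \<Rightarrow> 'a set. (\<forall>n. open (U n)) \<and> decseq U \<and> (\<Inter>n. U n) = F"
proof (intro exI conjI allI)
  let ?U = "\<lambda>n. \<Union>x\<in>F. ball x (1 / real (Suc n))"
  show "open (?U n)" for n by auto
  show "decseq ?U"
  proof (rule decseq_SucI)
    fix n
    have "1 / real (Suc (Suc n)) \<le> 1 / real (Suc n)" by (simp add: frac_le)
    then have "ball x (1 / real (Suc (Suc n))) \<subseteq> ball x (1 / real (Suc n))" for x :: 'a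
      by (rule subset_ball)
    then show "?U (Suc n) \<subseteq> ?U n" by blast
  qed
  show "(\<Inter>n. ?U n) = F"
  proof (intro equalityI subsetI)
    fix y assume y: "y \<in> (\<Inter>n. ?U n)"
    have "\<exists>x\<in>F. dist x y < e" if "e > 0" for e
    proof -
      obtain n where n: "1 / real (Suc n) < e" using nat_approx_posE[OF \<open>e > 0\<close>] by blast
      from y obtain x where "x \<in> F" "dist x y < 1 / real (Suc n)" by auto
      then show ?thesis using n by (intro bexI[of _ x]) auto
    qed
    then show "y \<in> F"
      using closed_approachable[OF \<open>closed F\<close>] by blast
  next
    fix y assume "y \<in> F"
    then show "y \<in> (\<Inter>n. ?U n)"
      by (auto intro!: bexI[of _ y])
  qed
qed

text \<open>Induction over the sigma-algebra generated by the closed sets. Closed sets are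
  decreasing limits of open neighbourhoods, and complements exchange the two roles. For a countable
  union all outer sets but only finitely many inner ones are joined, so that the inner set stays
  closed.\<close>

lemma closed_open_approximation:
  fixes M :: "'a::metric_space measure"
  assumes fin: "finite_measure M" and sets: "sets M = sets borel" and "A \<in> sets M" "e > 0"
  shows "\<exists>F U. closed F \<and> open U \<and> F \<subseteq> A \<and> A \<subseteq> U \<and> measure M (U - F) < e"
proof -
  interpret finite_measure M by fact
  have meas [measurable]: "closed F \<Longrightarrow> F \<in> sets M" "open U \<Longrightarrow> U \<in> sets M" for F U
    by (auto simp: sets)
  have "A \<in> sigma_sets UNIV (Collect closed)"
    using \<open>A \<in> sets M\<close> unfolding sets by (simp add: borel_eq_closed)
  then show ?thesis
    using \<open>e > 0\<close>
  proof (induction arbitrary: e)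
    case (Basic F)
    then have "closed F" by simp
    then have "\<exists>U :: nat \<Rightarrow> 'a set. (\<forall>n. open (U n)) \<and> decseq U \<and> (\<Inter>n. U n) = F"
      by (rule closed_eq_INT_open)
    then obtain U :: "nat \<Rightarrow> 'a set" where U: "\<forall>n. open (U n)" "decseq U" "(\<Inter>n. U n) = F"
      by (elim exE conjE) (rule that)
    have "(\<lambda>n. measure M (U n - F)) \<longlonglongrightarrow> measure M (\<Inter>n. U n - F)"
    proof (rule finite_Lim_measure_decseq)
      show "range (\<lambda>n. U n - F) \<subseteq> sets M"
        using meas U(1) \<open>closed F\<close> by blast
      show "decseq (\<lambda>n. U n - F)"
        using U(2) unfolding decseq_def by blast
    qed
    also have "(\<Inter>n. U n - F) = {}" using U(3) by blast
    finally have "\<forall>\<^sub>F n in sequentially. measure M (U n - F) < e"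
      using Basic.prems by (intro order_tendstoD) auto
    then obtain n where "measure M (U n - F) < e"
      using eventually_happens'[OF sequentially_bot] by blast
    then show ?case
      using U(1) U(3) \<open>closed F\<close> by (intro exI[of _ F] exI[of _ "U n"] conjI) blast+
  next
    case Empty
    then show ?case by (intro exI[of _ "{}"]) auto
  next
    case (Compl A)
    obtain F U where "closed F" "open U" "F \<subseteq> A" "A \<subseteq> U" "measure M (U - F) < e"
      using Compl.IH[OF Compl.prems] by blast
    moreover have "- F - (- U) = U - F" by blast
    moreover have "UNIV - A = - A" by blast
    ultimately have "closed (- U) \<and> open (- F) \<and> - U \<subseteq> UNIV - A \<and> UNIV - A \<subseteq> - F \<and>
        measure M (- F - (- U)) < e"
      by (simp add: closed_Compl open_Compl)
    then show ?case by blast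
  next
    case (Union A)
    \<comment> \<open>The errors sum to \<open>e / 2\<close>, so the limit is strictly below
      \<open>e\<close>, and then so is a finite stage.\<close>
    define \<delta> where "\<delta> i = e / 2 * (1 / 2) ^ Suc i" for i :: nat
    have \<delta>: "\<delta> i > 0" for i unfolding \<delta>_def using Union.prems by (intro mult_pos_pos) auto
    have "\<delta> = (\<lambda>i. e / 2 * (1 / 2) ^ Suc i)"
      by (rule ext) (rule \<delta>_def)
    then have sums: "\<delta> sums (e / 2)"
      using sums_mult[OF power_half_series, of "e / 2"] by (simp only: mult_1_right)
    have "summable \<delta>"
      using sums by (rule sums_summable)
    have suminf_\<delta>: "suminf \<delta> = e / 2"
      using sums by (rule sums_unique[symmetric])
    have "\<exists>F U. closed F \<and> open U \<and> F \<subseteq> A i \<and> A i \<subseteq> U \<and> measure M (U - F) < \<delta> i" for i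
      by (rule Union.IH) (rule \<delta>)
    then obtain F where "\<forall>i. \<exists>U. closed (F i) \<and> open U \<and> F i \<subseteq> A i \<and> A i \<subseteq> U \<and> measure M (U - F i) < \<delta> i"
      using choice[of "\<lambda>i F. \<exists>U. closed F \<and> open U \<and> F \<subseteq> A i \<and> A i \<subseteq> U \<and> measure M (U - F) < \<delta> i"]
      by blast
    then obtain U where "\<forall>i. closed (F i) \<and> open (U i) \<and> F i \<subseteq> A i \<and> A i \<subseteq> U i \<and> measure M (U i - F i) < \<delta> i"
      using choice[of "\<lambda>i U. closed (F i) \<and> open U \<and> F i \<subseteq> A i \<and> A i \<subseteq> U \<and> measure M (U - F i) < \<delta> i"]
      by blast
    then have FU: "\<And>i. closed (F i)" "\<And>i. open (U i)" "\<And>i. F i \<subseteq> A i" "\<And>i. A i \<subseteq> U i"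
        "\<And>i. measure M (U i - F i) < \<delta> i"
      by blast+
    define V where "V = (\<Union>i. U i)"
    define G where "G n = (\<Union>i<n. F i)" for n
    have [measurable]: "F i \<in> sets M" "U i \<in> sets M" for i
      by (rule meas, rule FU)+
    have [measurable]: "V \<in> sets M" "G n \<in> sets M" for n
      unfolding V_def G_def by measurable
    have "(\<lambda>n. measure M (V - G n)) \<longlonglongrightarrow> measure M (\<Inter>n. V - G n)"
    proof (rule finite_Lim_measure_decseq)
      show "decseq (\<lambda>n. V - G n)"
        by (rule decseq_SucI) (auto simp: G_def lessThan_Suc)
    qed auto
    moreover have "measure M (\<Inter>n. V - G n) < e"
    proof -
      have "summable (\<lambda>i. measure M (U i - F i))"
        using FU(5) by (intro summable_comparison_test'[OF \<open>summable \<delta>\<close>]) (auto simp: less_imp_le)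
      have "(\<Inter>n. V - G n) \<subseteq> (\<Union>i. U i - F i)"
        by (auto simp: V_def G_def)
      then have "measure M (\<Inter>n. V - G n) \<le> measure M (\<Union>i. U i - F i)"
        by (intro finite_measure_mono) auto
      also have "\<dots> \<le> (\<Sum>i. measure M (U i - F i))"
        using \<open>summable (\<lambda>i. measure M (U i - F i))\<close>
        by (intro finite_measure_subadditive_countably) auto
      also have "\<dots> \<le> suminf \<delta>"
        using FU(5) \<open>summable \<delta>\<close> \<open>summable (\<lambda>i. measure M (U i - F i))\<close>
        by (intro suminf_le) (auto simp: less_imp_le)
      finally show ?thesis using suminf_\<delta> Union.prems by simp
    qed
    ultimately have "\<forall>\<^sub>F n in sequentially. measure M (V - G n) < e"
      by (rule order_tendstoD)
    then obtain n where "measure M (V - G n) < e"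
      using eventually_happens'[OF sequentially_bot] by blast
    moreover have "closed (G n)" "open V"
      using FU by (auto simp: G_def V_def)
    moreover have "G n \<subseteq> (\<Union>i. A i)"
      using FU(3) unfolding G_def by blast
    moreover have "(\<Union>i. A i) \<subseteq> V"
      using FU(4) unfolding V_def by blast
    ultimately show ?case
      by (intro exI[of _ "G n"] exI[of _ V] conjI)
  qed
qed

lemma compact_closed_separated:
  fixes S T :: "'a::metric_space set"
  assumes "compact S" "closed T" "S \<inter> T = {}"
  obtains e :: real where "e > 0" "\<And>x y. x \<in> S \<Longrightarrow> y \<in> T \<Longrightarrow> e \<le> dist x y"
proof (cases "S = {} \<or> T = {}")
  case True
  then show ?thesis using that[of 1] by auto
next
  case False
  moreover have "continuous_on S (\<lambda>x. infdist x T)"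
    by (intro continuous_intros)
  ultimately obtain x where x: "x \<in> S" "\<And>y. y \<in> S \<Longrightarrow> infdist x T \<le> infdist y T"
    using continuous_attains_inf[OF \<open>compact S\<close>, of "\<lambda>x. infdist x T"] by blast
  have "infdist x T > 0"
    using x False assms by (intro infdist_pos_not_in_closed) auto
  then show ?thesis
  proof (rule that)
    fix y z assume "y \<in> S" "z \<in> T"
    then show "infdist x T \<le> dist y z"
      using x(2)[of y] infdist_le[of z T y] by linarith
  qed
qed

lemma uniformly_separated:
  fixes K :: "'b \<Rightarrow> 'a::metric_space set"
  assumes "finite P" and K: "\<And>A. A \<in> P \<Longrightarrow> compact (K A)"
    and disj: "\<And>A B. A \<in> P \<Longrightarrow> B \<in> P \<Longrightarrow> A \<noteq> B \<Longrightarrow> K A \<inter> K B = {}"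
  shows "\<exists>e>0::real. \<forall>A B x y. A \<in> P \<longrightarrow> B \<in> P \<longrightarrow> A \<noteq> B \<longrightarrow> x \<in> K A \<longrightarrow> y \<in> K B \<longrightarrow> e \<le> dist x y"
proof -
  define Q where "Q = {(A, B). A \<in> P \<and> B \<in> P \<and> A \<noteq> B}"
  have "finite Q"
    by (rule finite_subset[of _ "P \<times> P"]) (use \<open>finite P\<close> in \<open>auto simp: Q_def\<close>)
  have "\<exists>e>0::real. \<forall>x\<in>K (fst p). \<forall>y\<in>K (snd p). e \<le> dist x y" if "p \<in> Q" for p
  proof -
    have p: "fst p \<in> P" "snd p \<in> P" "fst p \<noteq> snd p"
      using that by (auto simp: Q_def)
    have "compact (K (fst p))" "closed (K (snd p))" "K (fst p) \<inter> K (snd p) = {}"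
      using K[OF p(1)] compact_imp_closed[OF K[OF p(2)]] disj[OF p] by simp_all
    then obtain e :: real where "e > 0" "\<And>x y. x \<in> K (fst p) \<Longrightarrow> y \<in> K (snd p) \<Longrightarrow> e \<le> dist x y"
      by (rule compact_closed_separated) blast
    then show ?thesis by blast
  qed
  then obtain e :: "'b \<times> 'b \<Rightarrow> real"
    where e: "\<And>p. p \<in> Q \<Longrightarrow> e p > 0" "\<And>p x y. p \<in> Q \<Longrightarrow> x \<in> K (fst p) \<Longrightarrow> y \<in> K (snd p) \<Longrightarrow> e p \<le> dist x y"
    by metis
  \<comment> \<open>Inserting 1 gives the minimum a value when there are no pairs.\<close>
  have "Min (insert 1 (e ` Q)) > 0"
    using \<open>finite Q\<close> e(1) by simp
  moreover have "Min (insert 1 (e ` Q)) \<le> dist x y"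
    if "A \<in> P" "B \<in> P" "A \<noteq> B" "x \<in> K A" "y \<in> K B" for A B x y
  proof -
    have "(A, B) \<in> Q" using that by (simp add: Q_def)
    then have "Min (insert 1 (e ` Q)) \<le> e (A, B)"
      using \<open>finite Q\<close> by (intro Min_le) auto
    also have "\<dots> \<le> dist x y"
      using e(2)[OF \<open>(A, B) \<in> Q\<close>] that by simp
    finally show ?thesis .
  qed
  ultimately show ?thesis by blast
qed

section \<open>Entropy\<close>

text \<open>From \<open>ln x \<le> x - 1\<close> at \<open>x = q / p\<close>. Summed over words with
  weights \<open>q\<close> of total at most 1, it bounds the entropy by the mean of
  \<open>- ln q\<close> plus 1.\<close>

lemma neg_mult_ln_le:
  fixes p q :: real
  assumes "p \<ge> 0" "q > 0"
  shows "- (p * ln p) \<le> q - p * ln q"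
proof (cases "p = 0")
  case False
  then have "p > 0" using assms by simp
  then have "ln (q / p) \<le> q / p - 1"
    using assms by (intro ln_le_minus_one) simp
  then have "p * (ln q - ln p) \<le> p * (q / p - 1)"
    using \<open>p > 0\<close> assms by (intro mult_left_mono) (auto simp: ln_div)
  then have "p * ln q - p * ln p \<le> q - p"
    using \<open>p > 0\<close> by (simp add: right_diff_distrib)
  then show ?thesis using \<open>p > 0\<close> by linarith
qed (use assms in simp)

lemma neg_mult_ln_nonneg:
  fixes p :: real
  assumes "0 \<le> p" "p \<le> 1"
  shows "- (p * ln p) \<ge> 0"
proof (cases "p = 0")
  case False
  then have "ln p \<le> 0" using assms by simp
  then show ?thesis using assms by (simp add: mult_nonneg_nonpos)
qed simp

lemma (in prob_space) prob_not_tendsto_0: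
  assumes [measurable]: "\<And>n. Measurable.pred M (P n)"
    and ev: "AE x in M. \<forall>\<^sub>F n in sequentially. P n x"
  shows "(\<lambda>n. prob {x \<in> space M. \<not> P n x}) \<longlonglongrightarrow> 0"
proof -
  let ?f = "\<lambda>n. indicator {x \<in> space M. \<not> P n x} :: 'a \<Rightarrow> real"
  have "(\<lambda>n. expectation (?f n)) \<longlonglongrightarrow> expectation (\<lambda>_. 0)"
  proof (rule integral_dominated_convergence[where w = "\<lambda>_. 1"])
    show "AE x in M. (\<lambda>n. ?f n x) \<longlonglongrightarrow> 0"
      using ev
    proof eventually_elim
      case (elim x)
      then have "\<forall>\<^sub>F n in sequentially. ?f n x = 0"
        by eventually_elim simp
      then show ?case by (rule tendsto_eventually)
    qed
    show "AE x in M. norm (?f n x) \<le> 1" for n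
      by (auto simp: indicator_def)
  qed auto
  then show ?thesis by simp
qed

context coded_ergodic_system
begin

text \<open>When slow decay holds at every positive rate, at most \<open>exp (e / 2 * n)\<close>
  words carry all but a vanishing share \<open>b n\<close> of the measure. They contribute at most
  \<open>e / 2 * n + 1\<close>, the others at most \<open>b n * n * ln (card A) + 1\<close>.\<close>

lemma cylinder_entropy_tendsto_0:
  assumes slow: "\<And>r. r > 0 \<Longrightarrow> prob (slow_decay r) = 1"
    and Q: "\<And>n. n > 0 \<Longrightarrow> Q n \<subseteq> cylinder ` {w \<in> lists A. length w = n}"
  shows "(\<lambda>n. partition_entropy M (Q n) / real n) \<longlonglongrightarrow> 0"
proof -
  define words where "words n = {w \<in> lists A. length w = n}" for n
  have fin: "finite (words n)" for n
    unfolding words_def by (rule finite_words[OF finite_A])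
  define p where "p w = prob (cylinder w)" for w
  define H where "H n = (\<Sum>w\<in>words n. - (p w * ln (p w)))" for n
  have \<phi>: "- (prob D * ln (prob D)) \<ge> 0" for D
    by (intro neg_mult_ln_nonneg) auto
  have entropy: "partition_entropy M (Q n) = (\<Sum>D\<in>Q n. - (prob D * ln (prob D)))" for n
    by (simp add: partition_entropy_def sum_negf)
  have H_ge: "partition_entropy M (Q n) \<le> H n" if "n > 0" for n
  proof -
    have "partition_entropy M (Q n) \<le> (\<Sum>D\<in>cylinder ` words n. - (prob D * ln (prob D)))"
      unfolding entropy using Q[OF that] fin \<phi> by (intro sum_mono2) (auto simp: words_def)
    \<comment> \<open>Words that never occur share the empty cylinder, so \<open>cylinder\<close>
      need not be injective; as the terms are nonnegative, the inequality survives.\<close>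
    also have "\<dots> \<le> H n"
      unfolding H_def p_def
      using sum_image_le[where I = "words n" and f = cylinder and g = "\<lambda>D. - (prob D * ln (prob D))", OF fin] \<phi>
      by (simp add: o_def)
    finally show ?thesis .
  qed
  have "\<forall>\<^sub>F n in sequentially. partition_entropy M (Q n) / real n < e" if "e > 0" for e
  proof -
    obtain W where W: "\<And>k. W k \<subseteq> words k" "\<And>k. card (W k) \<le> exp (e / 2 * real k)"
      "AE x in M. \<forall>\<^sub>F k in sequentially. word k x \<in> W k"
      using AE_word_in_small_sets[of "e / 4" "e / 2"] slow[of "e / 4"] \<open>e > 0\<close>
      unfolding words_def by auto
    define b where "b n = prob {x \<in> space M. word n x \<notin> W n}" for n
    have "b \<longlonglongrightarrow> 0"
      unfolding b_def using W(3) by (intro prob_not_tendsto_0) auto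
    have H_le: "H n \<le> e / 2 * real n + b n * (real n * ln (card A)) + 2" for n
    proof -
      have split: "words n = W n \<union> (words n - W n)" "W n \<inter> (words n - W n) = {}"
        using W(1) by auto
      have fin_W: "finite (W n)"
        using W(1) fin finite_subset by blast
      have len: "length w = n" if "w \<in> words n" for w
        using that by (simp add: words_def)
      \<comment> \<open>Comparison with the weight \<open>exp (- (e / 2 * n))\<close> for each word
        of \<open>W n\<close>; the size of \<open>W n\<close> keeps the total at most 1.\<close>
      have "(\<Sum>w\<in>W n. - (p w * ln (p w))) \<le> (\<Sum>w\<in>W n. exp (- (e / 2 * real n)) + p w * (e / 2 * real n))"
      proof (rule sum_mono)
        fix w
        show "- (p w * ln (p w)) \<le> exp (- (e / 2 * real n)) + p w * (e / 2 * real n)"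
          using neg_mult_ln_le[of "p w" "exp (- (e / 2 * real n))"] by (simp add: p_def)
      qed
      also have "\<dots> = card (W n) * exp (- (e / 2 * real n)) + (\<Sum>w\<in>W n. p w) * (e / 2 * real n)"
        by (simp only: sum.distrib sum_distrib_right sum_constant)
      also have "\<dots> \<le> exp (e / 2 * real n) * exp (- (e / 2 * real n)) + 1 * (e / 2 * real n)"
      proof (intro add_mono mult_right_mono W(2))
        show "(\<Sum>w\<in>W n. p w) \<le> 1"
          unfolding p_def using fin_W W(1)[of n] len by (intro sum_prob_cylinder_le_1) auto
      qed (use \<open>e > 0\<close> in auto)
      also have "\<dots> = 1 + e / 2 * real n"
        by (simp flip: exp_add)
      finally have A1: "(\<Sum>w\<in>W n. - (p w * ln (p w))) \<le> 1 + e / 2 * real n" .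
      have m: "real (card A) > 0" "ln (real (card A)) \<ge> 0"
        using card_A_ge_1 by auto
      \<comment> \<open>The remaining words are compared with the uniform weight on all words of
        length \<open>n\<close>.\<close>
      have "(\<Sum>w\<in>words n - W n. - (p w * ln (p w))) \<le>
          (\<Sum>w\<in>words n - W n. 1 / real (card A) ^ n + p w * (real n * ln (card A)))"
      proof (rule sum_mono)
        fix w
        have "ln (1 / real (card A) ^ n) = - (real n * ln (card A))"
          using m by (simp add: ln_div ln_realpow)
        then show "- (p w * ln (p w)) \<le> 1 / real (card A) ^ n + p w * (real n * ln (card A))"
          using neg_mult_ln_le[of "p w" "1 / real (card A) ^ n"] m by (simp add: p_def)
      qed
      also have "\<dots> = card (words n - W n) * (1 / real (card A) ^ n) +
          (\<Sum>w\<in>words n - W n. p w) * (real n * ln (card A))"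
        by (simp only: sum.distrib sum_distrib_right sum_constant)
      also have "\<dots> \<le> real (card A) ^ n * (1 / real (card A) ^ n) + b n * (real n * ln (card A))"
      proof (intro add_mono mult_right_mono)
        have "card (words n - W n) \<le> card (words n)"
          using fin by (intro card_mono) auto
        then show "real (card (words n - W n)) \<le> real (card A) ^ n"
          using card_words[OF finite_A, of n] unfolding words_def
          by (metis of_nat_le_iff of_nat_power)
        have "disjoint_family_on cylinder (words n - W n)"
          using len by (auto simp: disjoint_family_on_def cylinder_def)
        then have "(\<Sum>w\<in>words n - W n. p w) = prob (\<Union>w\<in>words n - W n. cylinder w)"
          unfolding p_def using fin by (intro finite_measure_finite_Union[symmetric]) auto
        also have "\<dots> \<le> b n"
          unfolding b_def using len by (intro finite_measure_mono) (auto simp: cylinder_def)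
        finally show "(\<Sum>w\<in>words n - W n. p w) \<le> b n" .
      qed (use m in auto)
      also have "\<dots> = 1 + b n * (real n * ln (card A))"
        using m by simp
      finally have A2: "(\<Sum>w\<in>words n - W n. - (p w * ln (p w))) \<le> 1 + b n * (real n * ln (card A))" .
      have "H n = (\<Sum>w\<in>W n. - (p w * ln (p w))) + (\<Sum>w\<in>words n - W n. - (p w * ln (p w)))"
        unfolding H_def using W(1) fin by (subst sum.subset_diff[of "W n"]) auto
      then show ?thesis using A1 A2 by linarith
    qed
    have "(\<lambda>n. e / 2 + b n * ln (card A) + 2 / real n) \<longlonglongrightarrow> e / 2 + 0 * ln (card A) + 0"
      by (intro tendsto_add tendsto_mult tendsto_const \<open>b \<longlonglongrightarrow> 0\<close> lim_const_over_n)
    then have "\<forall>\<^sub>F n in sequentially. e / 2 + b n * ln (card A) + 2 / real n < e"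
      by (rule order_tendstoD) (use \<open>e > 0\<close> in simp)
    then show ?thesis
      using eventually_gt_at_top[of 0]
    proof eventually_elim
      case (elim n)
      have "partition_entropy M (Q n) / real n \<le>
          (e / 2 * real n + b n * (real n * ln (card A)) + 2) / real n"
        using H_ge[of n] H_le[of n] elim(2) by (intro divide_right_mono) auto
      also have "\<dots> = e / 2 + b n * ln (card A) + 2 / real n"
        using elim(2) by (simp add: add_divide_distrib)
      finally show ?case using elim(1) by linarith
    qed
  qed
  moreover have "partition_entropy M (Q n) / real n \<ge> 0" for n
    unfolding entropy by (intro divide_nonneg_nonneg sum_nonneg \<phi>) auto
  then have "\<forall>\<^sub>F n in sequentially. a < partition_entropy M (Q n) / real n" if "a < 0" for a
    using that by (intro always_eventually allI) (meson less_le_trans)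
  ultimately show ?thesis
    by (intro order_tendstoI)
qed

end

section \<open>Coding by the atoms of a partition\<close>

definition atom :: "'a set set \<Rightarrow> 'a \<Rightarrow> 'a set" where
  "atom P x = (THE A. A \<in> P \<and> x \<in> A)"

lemma atom_eq:
  assumes P: "partition_on X P" and "A \<in> P" "x \<in> A"
  shows "atom P x = A"
  unfolding atom_def
proof (rule the_equality)
  fix B assume "B \<in> P \<and> x \<in> B"
  then show "B = A"
    using P \<open>A \<in> P\<close> \<open>x \<in> A\<close> unfolding partition_on_def disjoint_def by blast
qed (use assms in blast)

lemma atom_in:
  assumes P: "partition_on X P" and "x \<in> X"
  shows "atom P x \<in> P" "x \<in> atom P x"
proof -
  obtain A where A: "A \<in> P" "x \<in> A"
    using assms unfolding partition_on_def by blast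
  then have "atom P x = A" by (rule atom_eq[OF P])
  then show "atom P x \<in> P" "x \<in> atom P x" using A by simp_all
qed

context ergodic_system
begin

lemma coded_ergodic_system_atom:
  assumes P: "finite_measurable_partition M P"
  shows "coded_ergodic_system M f (atom P) P"
proof unfold_locales
  have part: "partition_on (space M) P" and "finite P" "P \<subseteq> sets M"
    using P by (auto simp: finite_measurable_partition_def)
  show "finite P" by fact
  have "atom P -` {A} \<inter> space M = A" if "A \<in> P" for A
  proof (intro equalityI subsetI)
    fix x assume "x \<in> atom P -` {A} \<inter> space M"
    then show "x \<in> A" using atom_in(2)[OF part, of x] by auto
  next
    fix x assume "x \<in> A"
    moreover have "A \<subseteq> space M" using \<open>P \<subseteq> sets M\<close> that sets.sets_into_space by blast
    ultimately show "x \<in> atom P -` {A} \<inter> space M"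
      using atom_eq[OF part that] by auto
  qed
  then show "atom P \<in> measurable M (count_space P)"
    using \<open>P \<subseteq> sets M\<close> atom_in(1)[OF part]
    by (auto simp: measurable_count_space_eq2[OF \<open>finite P\<close>])
qed

text \<open>A cell arises by choosing one piece from each partition, and any point \<open>x\<close>
  of the cell determines these choices: the piece for time \<open>i\<close> consists of the points
  whose letter at time \<open>i\<close> agrees with that of \<open>x\<close>. Equal partitions at
  different times share one choice, which is consistent with this.\<close>

lemma iterated_partition_subset_cylinder:
  assumes P: "finite_measurable_partition M P" and "n > 0"
  shows "iterated_partition f M n P \<subseteq>
    coded_ergodic_system.cylinder M f (atom P) ` {w \<in> lists P. length w = n}"
proof
  interpret coded_ergodic_system M f "atom P" P
    using P by (rule coded_ergodic_system_atom)
  have part: "partition_on (space M) P"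
    using P by (simp add: finite_measurable_partition_def)
  define Q where "Q i = ((\<lambda>A. (f ^^ i) -` A \<inter> space M) ` P) - {{}}" for i
  fix D assume "D \<in> iterated_partition f M n P"
  then have "D \<in> common_refinement (Q ` {..<n})"
    by (simp add: iterated_partition_def Q_def)
  then obtain g where g: "\<And>R. R \<in> Q ` {..<n} \<Longrightarrow> g R \<in> R" and D: "D = \<Inter> (g ` Q ` {..<n})" and "D \<noteq> {}"
    unfolding common_refinement by (auto simp: Pi_iff)
  then obtain x where x: "x \<in> D" by blast
  have gQ: "g (Q i) \<in> Q i" "x \<in> g (Q i)" if "i < n" for i
    using g[of "Q i"] x that unfolding D by auto
  have "x \<in> space M"
    using gQ[OF \<open>n > 0\<close>] by (auto simp: Q_def)
  have eq: "g (Q i) = {y \<in> space M. atom P ((f ^^ i) y) = atom P ((f ^^ i) x)}" if i: "i < n" for i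
  proof -
    obtain A where A: "A \<in> P" "g (Q i) = (f ^^ i) -` A \<inter> space M"
      using gQ(1)[OF i] by (auto simp: Q_def)
    have "(f ^^ i) x \<in> A" using gQ(2)[OF i] A by simp
    then have "atom P ((f ^^ i) x) = A" using A atom_eq[OF part] by blast
    moreover have "(f ^^ i) y \<in> A \<longleftrightarrow> atom P ((f ^^ i) y) = A" if "y \<in> space M" for y
      using atom_eq[OF part A(1)] atom_in(2)[OF part funpow_space[OF that, of i]] by blast
    ultimately show ?thesis
      unfolding A(2) by auto
  qed
  have "D = cylinder (word n x)"
  proof (intro set_eqI)
    fix y
    have "y \<in> D \<longleftrightarrow> (\<forall>i<n. y \<in> space M \<and> atom P ((f ^^ i) y) = atom P ((f ^^ i) x))"
      unfolding D using eq by auto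
    also have "\<dots> \<longleftrightarrow> y \<in> space M \<and> word n y = word n x"
      using \<open>n > 0\<close> by (auto simp: list_eq_iff_nth_eq nth_word)
    finally show "y \<in> D \<longleftrightarrow> y \<in> cylinder (word n x)"
      by (simp add: cylinder_def)
  qed
  then show "D \<in> cylinder ` {w \<in> lists P. length w = n}"
    using word_in_lists[OF \<open>x \<in> space M\<close>, of n] by (intro image_eqI[of _ _ "word n x"]) auto
qed

text \<open>Take a partition of positive entropy. If slow decay were null at no positive rate, the
  zero-one law would give it full measure at all of them, and the entropy of the partition would be
  0.\<close>

lemma positive_entropy_imp_fast_decay:
  assumes "measure_entropy f M > 0"
  obtains P and r :: real where "finite_measurable_partition M P" "r > 0"
    "prob (coded_ergodic_system.slow_decay M f (atom P) r) = 0"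
proof -
  obtain P where P: "finite_measurable_partition M P" and pos: "partition_dynamical_entropy f M P > 0"
    using assms unfolding measure_entropy_def less_SUP_iff by blast
  interpret coded_ergodic_system M f "atom P" P
    using P by (rule coded_ergodic_system_atom)
  have "\<exists>r>0. prob (slow_decay r) = 0"
  proof (rule ccontr)
    assume neg: "\<not> (\<exists>r>0. prob (slow_decay r) = 0)"
    have "prob (slow_decay r) = 1" if "r > 0" for r
      using neg that prob_slow_decay_0_1[of r] by blast
    then have "(\<lambda>n. partition_entropy M (iterated_partition f M n P) / real n) \<longlonglongrightarrow> 0"
      using iterated_partition_subset_cylinder[OF P] by (rule cylinder_entropy_tendsto_0)
    then have "(\<lambda>n. ereal (partition_entropy M (iterated_partition f M n P) / real n)) \<longlonglongrightarrow> ereal 0"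
      by (rule tendsto_ereal)
    then have "partition_dynamical_entropy f M P = 0"
      unfolding partition_dynamical_entropy_def zero_ereal_def by (rule limI)
    then show False using pos by simp
  qed
  then show ?thesis using that[OF P] by blast
qed

end

section \<open>Return times\<close>

text \<open>The metric counterpart of \<open>shift_mismatches\<close>: a pair counts when it is at
  least \<open>e\<close> apart, rather than when its letters differ.\<close>

definition far_returns :: "('a::metric_space \<Rightarrow> 'a) \<Rightarrow> real \<Rightarrow> nat \<Rightarrow> nat \<Rightarrow> 'a \<Rightarrow> nat set" where
  "far_returns f e n k x = {i. i + k < n \<and> e \<le> dist ((f ^^ (i + k)) x) ((f ^^ i) x)}"

lemma finite_far_returns [simp]: "finite (far_returns f e n k x)"
  by (rule finite_subset[of _ "{..<n}"]) (auto simp: far_returns_def)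

lemma mistake_ball_card:
  assumes "y \<in> mistake_ball f g n x \<epsilon>"
  shows "card {i. i < n \<and> \<epsilon> \<le> dist ((f ^^ i) x) ((f ^^ i) y)} \<le> g n \<epsilon>"
proof -
  obtain \<Lambda> where \<Lambda>: "\<Lambda> \<subseteq> {..<n}" "card \<Lambda> \<ge> n - g n \<epsilon>" and y: "orbit_dist f \<Lambda> x y < \<epsilon>"
    using assms by (auto simp: mistake_ball_def mistake_index_sets_def orbit_ball_def)
  have fin: "finite \<Lambda>" using \<Lambda>(1) finite_subset by blast
  have "dist ((f ^^ i) x) ((f ^^ i) y) < \<epsilon>" if "i \<in> \<Lambda>" for i
  proof -
    have "dist ((f ^^ i) x) ((f ^^ i) y) \<le> orbit_dist f \<Lambda> x y"
      unfolding orbit_dist_def using fin that by (intro Max_ge) auto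
    then show ?thesis using y by simp
  qed
  then have "{i. i < n \<and> \<epsilon> \<le> dist ((f ^^ i) x) ((f ^^ i) y)} \<subseteq> {..<n} - \<Lambda>"
  proof (intro subsetI DiffI)
    fix i assume i: "i \<in> {i. i < n \<and> \<epsilon> \<le> dist ((f ^^ i) x) ((f ^^ i) y)}"
    then show "i \<in> {..<n}" by simp
    show "i \<notin> \<Lambda>"
    proof
      assume "i \<in> \<Lambda>"
      then have "dist ((f ^^ i) x) ((f ^^ i) y) < \<epsilon>" by fact
      then show False using i by simp
    qed
  qed
  then have "card {i. i < n \<and> \<epsilon> \<le> dist ((f ^^ i) x) ((f ^^ i) y)} \<le> card ({..<n} - \<Lambda>)"
    by (intro card_mono) auto
  also have "\<dots> = n - card \<Lambda>"
    using fin \<Lambda>(1) by (simp add: card_Diff_subset)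
  finally show ?thesis using \<Lambda>(2) by linarith
qed

text \<open>The point \<open>(f ^^ (i + k)) z\<close> shadows \<open>(f ^^ (i + k)) x\<close> along
  the orbit of \<open>z\<close> and \<open>(f ^^ i) x\<close> along that of
  \<open>(f ^^ k) z\<close>. If neither comparison is a mistake, the triangle inequality puts the
  two points of the orbit of \<open>x\<close> less than \<open>2 * \<epsilon>\<close> apart.\<close>

lemma card_far_returns_le:
  assumes z: "z \<in> mistake_ball f g n x \<epsilon>" "(f ^^ k) z \<in> mistake_ball f g n x \<epsilon>"
    and e: "2 * \<epsilon> \<le> e"
  shows "card (far_returns f e n k x) \<le> 2 * g n \<epsilon>"
proof -
  define S where "S y = {i. i < n \<and> \<epsilon> \<le> dist ((f ^^ i) x) ((f ^^ i) y)}" for y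
  define S' where "S' = {i. i + k \<in> S z}"
  have S_sub: "S y \<subseteq> {..<n}" for y
    unfolding S_def by blast
  then have fin_S: "finite (S y)" for y
    by (rule finite_subset) simp
  have image: "(\<lambda>i. i + k) ` S' \<subseteq> S z"
    unfolding S'_def by blast
  have inj: "inj_on (\<lambda>i. i + k) S'"
    by (simp add: inj_on_def)
  have fin_S': "finite S'"
    using finite_subset[OF image fin_S] inj by (rule finite_imageD)
  have S': "card S' \<le> g n \<epsilon>"
    using card_inj_on_le[OF inj image fin_S] mistake_ball_card[OF z(1)] unfolding S_def by linarith
  have "far_returns f e n k x \<subseteq> S' \<union> S ((f ^^ k) z)"
  proof
    fix i assume i: "i \<in> far_returns f e n k x"
    have eq: "(f ^^ i) ((f ^^ k) z) = (f ^^ (i + k)) z"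
      by (simp add: funpow_add)
    have "2 * \<epsilon> \<le> dist ((f ^^ (i + k)) x) ((f ^^ i) x)" "i + k < n" "i < n"
      using i e by (simp_all add: far_returns_def)
    moreover have "dist ((f ^^ (i + k)) x) ((f ^^ i) x) \<le>
        dist ((f ^^ (i + k)) x) ((f ^^ (i + k)) z) + dist ((f ^^ i) x) ((f ^^ (i + k)) z)"
      by (rule dist_triangle2)
    ultimately consider "\<epsilon> \<le> dist ((f ^^ (i + k)) x) ((f ^^ (i + k)) z)" "i + k < n"
      | "\<epsilon> \<le> dist ((f ^^ i) x) ((f ^^ (i + k)) z)" "i < n"
      by linarith
    then show "i \<in> S' \<union> S ((f ^^ k) z)"
    proof cases
      case 1
      then have "i \<in> S'" unfolding S'_def S_def by blast
      then show ?thesis by blast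
    next
      case 2
      then have "i \<in> S ((f ^^ k) z)" unfolding S_def mem_Collect_eq eq by blast
      then show ?thesis by blast
    qed
  qed
  then have "card (far_returns f e n k x) \<le> card (S' \<union> S ((f ^^ k) z))"
    by (rule card_mono[rotated]) (simp add: fin_S fin_S')
  also have "\<dots> \<le> card S' + card (S ((f ^^ k) z))" by (rule card_Un_le)
  also have "\<dots> \<le> g n \<epsilon> + g n \<epsilon>"
    using S' mistake_ball_card[OF z(2)] unfolding S_def by (rule add_mono)
  finally show ?thesis by simp
qed

text \<open>A nonempty set of extended naturals attains its infimum, so a finite return time comes
  with a returning point.\<close>

lemma min_return_time_cases:
  obtains (never) "min_return_time f g n x \<epsilon> = \<infinity>"
  | (return) k z where "min_return_time f g n x \<epsilon> = enat k" "k \<ge> 1"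
      "z \<in> mistake_ball f g n x \<epsilon>" "(f ^^ k) z \<in> mistake_ball f g n x \<epsilon>"
proof -
  define K where "K = {k. k \<ge> 1 \<and> (f ^^ k) -` mistake_ball f g n x \<epsilon> \<inter> mistake_ball f g n x \<epsilon> \<noteq> {}}"
  have S: "min_return_time f g n x \<epsilon> = Inf (enat ` K)"
    unfolding min_return_time_def K_def by (rule refl)
  show ?thesis
  proof (cases "K = {}")
    case True
    have "min_return_time f g n x \<epsilon> = \<infinity>"
      unfolding S True by (simp add: Inf_enat_def)
    then show ?thesis by (rule never)
  next
    case False
    then have "enat ` K \<noteq> {}" by simp
    then have min: "min_return_time f g n x \<epsilon> = (LEAST t. t \<in> enat ` K)"
      unfolding S Inf_enat_def by (rule if_not_P)
    have "(LEAST t. t \<in> enat ` K) \<in> enat ` K"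
      by (rule LeastI_ex) (use False in blast)
    then obtain k where k: "(LEAST t. t \<in> enat ` K) = enat k" "k \<in> K"
      by (rule imageE)
    then obtain z where "z \<in> (f ^^ k) -` mistake_ball f g n x \<epsilon>" "z \<in> mistake_ball f g n x \<epsilon>" "k \<ge> 1"
      unfolding K_def by blast
    with min show ?thesis
      unfolding k(1) by (intro return[of k z]) simp_all
  qed
qed

text \<open>A return at a time \<open>k \<le> c * n\<close> would leave at most
  \<open>2 * g n \<epsilon> \<le> d * n\<close> far returns; a ball that never returns gives an
  infinite quotient.\<close>

lemma min_return_time_ge:
  fixes c e d \<epsilon> :: real
  assumes far: "\<forall>k. 1 \<le> k \<and> real k \<le> c * real n \<longrightarrow> d * real n < real (card (far_returns f e n k x))"
    and g: "2 * real (g n \<epsilon>) \<le> d * real n" and "2 * \<epsilon> \<le> e" and "n > 0"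
  shows "ereal_of_enat (min_return_time f g n x \<epsilon>) / ereal (real n) \<ge> ereal c"
proof (cases rule: min_return_time_cases[of f g n x \<epsilon>])
  case never
  have "ereal_of_enat (min_return_time f g n x \<epsilon>) / ereal (real n) = \<infinity>"
    unfolding never using \<open>n > 0\<close> by simp
  then show ?thesis by (simp only: ereal_less_eq)
next
  case (return k z)
  have "card (far_returns f e n k x) \<le> 2 * g n \<epsilon>"
    using return(3,4) \<open>2 * \<epsilon> \<le> e\<close> by (rule card_far_returns_le)
  then have "\<not> d * real n < real (card (far_returns f e n k x))"
    using g by linarith
  then have "c * real n \<le> real k"
    using far[rule_format, of k] \<open>k \<ge> 1\<close> by linarith
  then have "c \<le> real k / real n"
    using \<open>n > 0\<close> by (simp add: pos_le_divide_eq)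
  then show ?thesis
    unfolding return(1) using \<open>n > 0\<close> by simp
qed

lemma min_return_time_le:
  assumes "n \<ge> 1" "mistake_ball f g n x \<epsilon> \<inter> (f ^^ n) -` mistake_ball f g n x \<epsilon> \<noteq> {}"
  shows "ereal_of_enat (min_return_time f g n x \<epsilon>) / ereal (real n) \<le> 1"
proof -
  have "min_return_time f g n x \<epsilon> \<le> enat n"
    unfolding min_return_time_def using assms by (intro Inf_lower) blast
  then obtain k where k: "min_return_time f g n x \<epsilon> = enat k" "k \<le> n"
    by (cases "min_return_time f g n x \<epsilon>") auto
  have "ereal_of_enat (min_return_time f g n x \<epsilon>) / ereal (real n) = ereal (real k / real n)"
    unfolding k(1) using \<open>n \<ge> 1\<close> by simp
  also have "\<dots> \<le> ereal 1"
    using k(2) \<open>n \<ge> 1\<close> by simp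
  finally show ?thesis by (simp only: one_ereal_def)
qed

text \<open>Compact cores of the atoms have a common positive distance \<open>e\<close>, so points
  in different atoms and outside the leftover set \<open>B\<close> are at least \<open>e\<close>
  apart. A mismatch between times \<open>i\<close> and \<open>i + k\<close> is thus a far return or
  a visit to \<open>B\<close> at one of the two times.\<close>

lemma AE_far_returns:
  fixes M :: "'a::metric_space measure" and f :: "'a \<Rightarrow> 'a" and c :: real
  assumes "compact (UNIV :: 'a set)" and sets: "sets M = sets borel" and "ergodic_system M f"
    and "measure_entropy f M > 0" and c: "0 < c" "c < 1"
  shows "\<exists>d>0. \<exists>e>0. AE x in M. \<forall>\<^sub>F n in sequentially.
    \<forall>k. 1 \<le> k \<and> real k \<le> c * real n \<longrightarrow> d * real n < real (card (far_returns f e n k x))"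
proof -
  interpret ergodic_system M f by fact
  obtain P and r :: real where P: "finite_measurable_partition M P" and "r > 0"
    and fast: "prob (coded_ergodic_system.slow_decay M f (atom P) r) = 0"
    using \<open>measure_entropy f M > 0\<close> by (rule positive_entropy_imp_fast_decay)
  interpret coded_ergodic_system M f "atom P" P
    using P by (rule coded_ergodic_system_atom)
  obtain d :: real where "d > 0" and mismatches: "AE x in M. \<forall>\<^sub>F n in sequentially.
      \<forall>k. 1 \<le> k \<and> real k \<le> c * real n \<longrightarrow> d * real n < real (shift_mismatches k (word n x))"
    using fast \<open>r > 0\<close> c by (rule AE_shift_mismatches)
  have part: "partition_on (space M) P" and "finite P" and "P \<subseteq> sets M"
    using P by (auto simp: finite_measurable_partition_def)
  have UNIV: "space M = UNIV"
    using sets_eq_imp_space_eq[OF sets] by simp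
  \<comment> \<open>Summed over the atoms, this error leaves \<open>B\<close> with measure below
    \<open>d / 8\<close>.\<close>
  define \<eta> where "\<eta> = d / (8 * (real (card P) + 1))"
  have "\<eta> > 0" using \<open>d > 0\<close> by (simp add: \<eta>_def)
  have "\<exists>F. closed F \<and> F \<subseteq> A \<and> prob (A - F) < \<eta>" if A: "A \<in> P" for A
  proof -
    have "A \<in> sets M" using \<open>P \<subseteq> sets M\<close> A by blast
    then obtain F U where FU: "closed F" "open U" "F \<subseteq> A" "A \<subseteq> U" "prob (U - F) < \<eta>"
      using closed_open_approximation[OF finite_measure_axioms sets \<open>A \<in> sets M\<close> \<open>\<eta> > 0\<close>]
      by (elim exE conjE) (rule that)
    have "U - F \<in> sets M"
      unfolding sets using FU(1,2) by (intro sets.Diff borel_open borel_closed)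
    moreover have "A - F \<subseteq> U - F" using FU(4) by blast
    ultimately have "prob (A - F) \<le> prob (U - F)"
      by (rule finite_measure_mono[rotated])
    then have "prob (A - F) < \<eta>" using FU(5) by linarith
    with FU(1,3) show ?thesis by blast
  qed
  then have "\<exists>K. \<forall>A\<in>P. closed (K A) \<and> K A \<subseteq> A \<and> prob (A - K A) < \<eta>"
    by (intro bchoice) blast
  then obtain K where K: "\<And>A. A \<in> P \<Longrightarrow> closed (K A)" "\<And>A. A \<in> P \<Longrightarrow> K A \<subseteq> A"
      "\<And>A. A \<in> P \<Longrightarrow> prob (A - K A) < \<eta>"
    by blast
  have compact_K: "compact (K A)" if "A \<in> P" for A
    using compact_Int_closed[OF \<open>compact UNIV\<close> K(1)[OF that]] by simp
  have disj_K: "K A \<inter> K A' = {}" if "A \<in> P" "A' \<in> P" "A \<noteq> A'" for A A'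
  proof -
    have "A \<inter> A' = {}"
      using part that unfolding partition_on_def disjoint_def by blast
    then show ?thesis using K(2)[OF that(1)] K(2)[OF that(2)] by blast
  qed
  have "\<exists>e>0::real. \<forall>A A' x y. A \<in> P \<longrightarrow> A' \<in> P \<longrightarrow> A \<noteq> A' \<longrightarrow> x \<in> K A \<longrightarrow> y \<in> K A' \<longrightarrow> e \<le> dist x y"
    using \<open>finite P\<close> compact_K disj_K by (rule uniformly_separated)
  then obtain e :: real where "e > 0"
    and e: "\<And>A A' x y. A \<in> P \<Longrightarrow> A' \<in> P \<Longrightarrow> A \<noteq> A' \<Longrightarrow> x \<in> K A \<Longrightarrow> y \<in> K A' \<Longrightarrow> e \<le> dist x y"
    by blast
  define B where "B = (\<Union>A\<in>P. A - K A)"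
  have B_sets [measurable]: "A - K A \<in> sets M" if "A \<in> P" for A
  proof (rule sets.Diff)
    show "A \<in> sets M" using \<open>P \<subseteq> sets M\<close> that by blast
    show "K A \<in> sets M" unfolding sets using K(1)[OF that] by (rule borel_closed)
  qed
  have "prob B \<le> (\<Sum>A\<in>P. prob (A - K A))"
    unfolding B_def using \<open>finite P\<close> B_sets by (intro finite_measure_subadditive_finite) auto
  also have "\<dots> \<le> (\<Sum>A\<in>P. \<eta>)"
    using K(3) by (intro sum_mono) (simp add: less_imp_le)
  also have "\<dots> = real (card P) * \<eta>" by simp
  also have "\<dots> < d / 8"
    using \<open>d > 0\<close> unfolding \<eta>_def by (simp add: field_simps)
  finally have "prob B < d / 8" .
  moreover have "B \<in> sets M"
    unfolding B_def using \<open>finite P\<close> B_sets by (intro sets.finite_UN) auto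
  ultimately have B_visits: "AE x in M. \<exists>K::nat. \<forall>n. visits f B n x \<le> d / 8 * real n + real K"
    by (intro AE_visits_le)
  have separated: "e \<le> dist y z" if "atom P y \<noteq> atom P z" "y \<notin> B" "z \<notin> B" for y z
  proof (rule e)
    show "atom P y \<in> P" "atom P z \<in> P" "y \<in> K (atom P y)" "z \<in> K (atom P z)"
      using that atom_in[OF part, of y] atom_in[OF part, of z] by (auto simp: UNIV B_def)
  qed (rule that(1))
  have le: "shift_mismatches k (word n x) \<le> card (far_returns f e n k x) + 2 * visits f B n x" for k n x
  proof -
    let ?V = "{i. i < n \<and> (f ^^ i) x \<in> B}"
    let ?S = "{i. i + k < n \<and> (f ^^ (i + k)) x \<in> B}"
    have fin: "finite ?V" "finite ?S"
      by (rule bounded_nat_set_is_finite[of _ n]; simp)+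
    have "card ?S = card ((\<lambda>i. i + k) ` ?S)"
      by (rule card_image[symmetric]) (simp add: inj_on_def)
    also have "\<dots> \<le> card ?V"
      by (rule card_mono[OF fin(1)]) blast
    finally have S: "card ?S \<le> visits f B n x" by (simp add: visits_def)
    have "{i. i + k < length (word n x) \<and> word n x ! (i + k) \<noteq> word n x ! i}
        \<subseteq> far_returns f e n k x \<union> ?V \<union> ?S"
    proof
      fix i assume "i \<in> {i. i + k < length (word n x) \<and> word n x ! (i + k) \<noteq> word n x ! i}"
      then have "i + k < n" and neq: "word n x ! (i + k) \<noteq> word n x ! i" by simp_all
      then have "i < n" by simp
      then have "atom P ((f ^^ (i + k)) x) \<noteq> atom P ((f ^^ i) x)"
        using neq \<open>i + k < n\<close> by (simp add: nth_word)
      then show "i \<in> far_returns f e n k x \<union> ?V \<union> ?S"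
        using separated[of "(f ^^ (i + k)) x" "(f ^^ i) x"] \<open>i + k < n\<close> \<open>i < n\<close>
        unfolding far_returns_def by blast
    qed
    then have "shift_mismatches k (word n x) \<le> card (far_returns f e n k x \<union> ?V \<union> ?S)"
      unfolding shift_mismatches_def using fin by (intro card_mono) auto
    also have "\<dots> \<le> card (far_returns f e n k x) + card ?V + card ?S"
      by (meson add_le_mono1 card_Un_le order_trans)
    finally show ?thesis using S by (simp add: visits_def)
  qed
  have "AE x in M. \<forall>\<^sub>F n in sequentially.
    \<forall>k. 1 \<le> k \<and> real k \<le> c * real n \<longrightarrow> d / 2 * real n < real (card (far_returns f e n k x))"
    using mismatches B_visits
  proof eventually_elim
    case (elim x)
    from elim(2) obtain K :: nat where K: "\<forall>n. visits f B n x \<le> d / 8 * real n + real K" by blast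
    have "\<forall>\<^sub>F n in sequentially. real n \<ge> K / (d / 8)"
      by (intro eventually_compose_filterlim[OF _ filterlim_real_sequentially] eventually_ge_at_top)
    with elim(1) show ?case
    proof eventually_elim
      case (elim n)
      \<comment> \<open>Visits now number at most \<open>d / 4 * n\<close>. Counted at both times of
        a pair, they explain at most \<open>d / 2 * n\<close> of the more than \<open>d * n\<close>
        mismatches.\<close>
      then have "real K \<le> d / 8 * real n"
        using \<open>d > 0\<close> by (simp add: field_simps)
      then have V: "real (visits f B n x) \<le> d / 4 * real n"
        using K[rule_format, of n] by linarith
      show ?case
      proof (intro allI impI)
        fix k assume "1 \<le> k \<and> real k \<le> c * real n"
        then have "d * real n < real (shift_mismatches k (word n x))"
          using elim(1) by blast
        also have "\<dots> \<le> real (card (far_returns f e n k x)) + 2 * real (visits f B n x)"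
          using le[of k n x] by linarith
        finally show "d / 2 * real n < real (card (far_returns f e n k x))"
          using V by linarith
      qed
    qed
  qed
  moreover have "d / 2 > 0" using \<open>d > 0\<close> by simp
  ultimately show ?thesis using \<open>e > 0\<close> by blast
qed

theorem theoremB:
  fixes f :: "'a::metric_space \<Rightarrow> 'a"
    and g :: "nat \<Rightarrow> real \<Rightarrow> nat"
    and \<epsilon>0 :: real
    and M :: "'a measure"
  assumes "\<epsilon>0 > 0"
    and "mistake_function \<epsilon>0 g"
    and "topological_dynamical_system f"
    and "almost_specification f g"
    and "sets M = sets borel"
    and "prob_space M"
    and "invariant_measure f M"
    and "ergodic_measure f M"
    and "measure_entropy f M > 0"
  shows "AE x in M.
     ((\<lambda>\<epsilon>. limsup (\<lambda>n. ereal_of_enat (min_return_time f g n x \<epsilon>) / ereal (real n)))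
        \<longlongrightarrow> 1) (at_right 0) \<and>
     ((\<lambda>\<epsilon>. liminf (\<lambda>n. ereal_of_enat (min_return_time f g n x \<epsilon>) / ereal (real n)))
        \<longlongrightarrow> 1) (at_right 0)"
proof -
  define R where "R x \<epsilon> n = ereal_of_enat (min_return_time f g n x \<epsilon>) / ereal (real n)" for x \<epsilon> n
  \<comment> \<open>Specification with \<open>x\<close> in both places and \<open>m = n\<close> is a
    return at time \<open>n\<close>.\<close>
  have upper: "\<forall>\<^sub>F \<epsilon> in at_right 0. limsup (R x \<epsilon>) \<le> 1" for x
    using \<open>almost_specification f g\<close> unfolding almost_specification_def
  proof eventually_elim
    case (elim \<epsilon>)
    then obtain N where N: "N > 0" "\<And>n. n \<ge> N \<Longrightarrow>
        mistake_ball f g n x \<epsilon> \<inter> (f ^^ n) -` mistake_ball f g n x \<epsilon> \<noteq> {}"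
      by blast
    have "\<forall>\<^sub>F n in sequentially. R x \<epsilon> n \<le> 1"
      using eventually_ge_at_top[of N]
    proof eventually_elim
      case (elim n)
      then show ?case
        unfolding R_def using N by (intro min_return_time_le) auto
    qed
    then show ?case by (rule Limsup_bounded)
  qed
  have "ergodic_system M f"
    using assms by (simp add: ergodic_system_def ergodic_system_axioms_def)
  \<comment> \<open>Countably many constants tending to 1, so that one null set serves them all; the
    shift by 2 makes each of them positive.\<close>
  define c where "c j = 1 - 1 / real (j + 2)" for j :: nat
  have c: "0 < c j" "c j < 1" for j
    by (simp_all add: c_def)
  have "AE x in M. \<exists>d>0. \<exists>e>0. \<forall>\<^sub>F n in sequentially.
    \<forall>k. 1 \<le> k \<and> real k \<le> c j * real n \<longrightarrow> d * real n < real (card (far_returns f e n k x))" for j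
  proof -
    obtain d e :: real where "d > 0" "e > 0" and AE: "AE x in M. \<forall>\<^sub>F n in sequentially.
        \<forall>k. 1 \<le> k \<and> real k \<le> c j * real n \<longrightarrow> d * real n < real (card (far_returns f e n k x))"
      using AE_far_returns[OF _ \<open>sets M = sets borel\<close> \<open>ergodic_system M f\<close> \<open>measure_entropy f M > 0\<close> c[of j]]
        \<open>topological_dynamical_system f\<close> unfolding topological_dynamical_system_def by blast
    from AE show ?thesis
      by eventually_elim (use \<open>d > 0\<close> \<open>e > 0\<close> in blast)
  qed
  then have "AE x in M. \<forall>j. \<exists>d>0. \<exists>e>0. \<forall>\<^sub>F n in sequentially.
    \<forall>k. 1 \<le> k \<and> real k \<le> c j * real n \<longrightarrow> d * real n < real (card (far_returns f e n k x))"
    by (subst AE_all_countable) blast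
  then show ?thesis
    unfolding R_def[symmetric]
  proof eventually_elim
    case (elim x)
    have lower: "\<forall>\<^sub>F \<epsilon> in at_right 0. liminf (R x \<epsilon>) \<ge> ereal (c j)" for j
    proof -
      obtain d e :: real where "d > 0" "e > 0" and far: "\<forall>\<^sub>F n in sequentially.
          \<forall>k. 1 \<le> k \<and> real k \<le> c j * real n \<longrightarrow> d * real n < real (card (far_returns f e n k x))"
        using elim by blast
      \<comment> \<open>Below \<open>\<epsilon>0\<close> the mistakes are sublinear in
        \<open>n\<close>; below \<open>e / 2\<close> two shadowing errors together stay under
        \<open>e\<close>.\<close>
      have "\<forall>\<^sub>F \<epsilon> in at_right 0. \<epsilon> \<in> {0<..<min \<epsilon>0 (e / 2)}"
        using \<open>\<epsilon>0 > 0\<close> \<open>e > 0\<close> by (intro eventually_at_right_real) simp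
      then show ?thesis
      proof eventually_elim
        case (elim \<epsilon>)
        have "(\<lambda>n. real (g n \<epsilon>) / real n) \<longlonglongrightarrow> 0"
          using \<open>mistake_function \<epsilon>0 g\<close> elim by (simp add: mistake_function_def)
        then have "\<forall>\<^sub>F n in sequentially. real (g n \<epsilon>) / real n < d / 2"
          using \<open>d > 0\<close> by (intro order_tendstoD) auto
        with far eventually_gt_at_top[of 0] have "\<forall>\<^sub>F n in sequentially. ereal (c j) \<le> R x \<epsilon> n"
        proof eventually_elim
          case (elim n)
          show ?case
            unfolding R_def
          proof (rule min_return_time_ge)
            show "2 * real (g n \<epsilon>) \<le> d * real n"
              using elim by (simp add: field_simps)
            show "2 * \<epsilon> \<le> e"
              using \<open>\<epsilon> \<in> {0<..<min \<epsilon>0 (e / 2)}\<close> by simp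
          qed (use elim in auto)
        qed
        then show ?case by (rule Liminf_bounded)
      qed
    qed
    \<comment> \<open>With this, a lower bound for \<open>liminf\<close> and an upper bound for
      \<open>limsup\<close> settle both limits.\<close>
    have Liminf_le: "liminf (R x \<epsilon>) \<le> limsup (R x \<epsilon>)" for \<epsilon>
      by (rule Liminf_le_Limsup) simp
    have gt: "\<forall>\<^sub>F \<epsilon> in at_right 0. a < liminf (R x \<epsilon>)" if "a < 1" for a
    proof -
      have "\<exists>j. a < ereal (c j)"
      proof -
        have "(\<lambda>j. ereal (c j)) \<longlonglongrightarrow> ereal 1"
          unfolding c_def using tendsto_diff[OF tendsto_const LIMSEQ_ignore_initial_segment[OF lim_1_over_n, of 2], of 1]
          by (intro tendsto_ereal) simp
        then have "\<forall>\<^sub>F j in sequentially. a < ereal (c j)"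
          using that by (intro order_tendstoD) (simp_all add: one_ereal_def)
        then show ?thesis using eventually_happens'[OF sequentially_bot] by blast
      qed
      then obtain j where "a < ereal (c j)" ..
      then show ?thesis
        using lower[of j] by (auto elim: eventually_mono)
    qed
    show ?case
    proof (intro conjI order_tendstoI)
      fix a :: ereal assume "a < 1"
      then show "\<forall>\<^sub>F \<epsilon> in at_right 0. a < liminf (R x \<epsilon>)" by (rule gt)
      then show "\<forall>\<^sub>F \<epsilon> in at_right 0. a < limsup (R x \<epsilon>)"
        by eventually_elim (use Liminf_le less_le_trans in blast)
    next
      fix a :: ereal assume a: "1 < a"
      from upper[of x] show "\<forall>\<^sub>F \<epsilon> in at_right 0. limsup (R x \<epsilon>) < a"
        by eventually_elim (rule le_less_trans[OF _ a])
      from upper[of x] show "\<forall>\<^sub>F \<epsilon> in at_right 0. liminf (R x \<epsilon>) < a"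
        by eventually_elim (rule le_less_trans[OF order_trans[OF Liminf_le] a])
    qed
  qed
qed

end
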